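(* Let $\alpha_1,\alpha_2,\beta\in\mathbb{R}$ with $\alpha_1\alpha_2<0$, and set $\beta_1=\beta_2=\beta$. Assume $s,b\in\mathbb{R}$ satisfy one of: (1) $s<-\frac{13}{12}$ and $b\in\mathbb{R}$; (2) $-\frac{13}{12}\le s\le -1$ and $b\notin[\frac14-\frac s3,\frac43+\frac{2s}3]$; (3) $-1<s<-\frac34$ and $b\notin[\frac14-\frac s3,1+\frac s3]$. Then there is no constant $C=C(\alpha_1,\alpha_2,\beta,s,b)$ such that \[ \|\partial_x(w_1w_2)\|_{X^{\alpha_1,\beta}_{s,b-1}}\le C\|w_1\|_{X^{\alpha_1,\beta}_{s,b}}\|w_2\|_{X^{\alpha_2,\beta}_{s,b}}\quad\text{for all }w_1,w_2. \]
   Context: For $\alpha\ne0$, $\beta\in\mathbb{R}$ let $\phi^{\alpha,\beta}(\xi)=\alpha\xi^3-\beta\xi$ and $\langle x\rangle=1+|x|$. For $s,b\in\mathbb{R}$ the Fourier restriction space $X^{\alpha,\beta}_{s,b}$ is the completion of the Schwartz space $\mathscr{S}(\mathbb{R}^2)$ under the norm $\|w\|_{X^{\alpha,\beta}_{s,b}}=\|\langle\xi\rangle^s\langle\tau-\phi^{\alpha,\beta}(\xi)\rangle^b\widehat w(\xi,\tau)\|_{L^2(d\xi\,d\tau)}$, where $\widehat w$ is the space-time Fourier transform. *)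

theory Defs
  imports "HOL-Analysis.Analysis"
begin

definition partial_x :: "(real \<times> real \<Rightarrow> complex) \<Rightarrow> real \<times> real \<Rightarrow> complex" where
  "partial_x f = (\<lambda>(x,t). vector_derivative (\<lambda>y. f (y,t)) (at x))"

definition partial_t :: "(real \<times> real \<Rightarrow> complex) \<Rightarrow> real \<times> real \<Rightarrow> complex" where
  "partial_t f = (\<lambda>(x,t). vector_derivative (\<lambda>s. f (x,s)) (at t))"

fun partials :: "bool list \<Rightarrow> (real \<times> real \<Rightarrow> complex) \<Rightarrow> real \<times> real \<Rightarrow> complex" where
  "partials [] f = f"
| "partials (d # ds) f = (if d then partial_x else partial_t) (partials ds f)"

definition schwartz :: "(real \<times> real \<Rightarrow> complex) \<Rightarrow> bool" where
  "schwartz f \<longleftrightarrow>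
     (\<forall>ds. (partials ds f) differentiable_on UNIV) \<and>
     (\<forall>ds (k::nat) (m::nat). bounded (range (\<lambda>(x,t). complex_of_real (x ^ k * t ^ m) * partials ds f (x,t))))"

definition fourier2 :: "(real \<times> real \<Rightarrow> complex) \<Rightarrow> real \<times> real \<Rightarrow> complex" where
  "fourier2 w = (\<lambda>(\<xi>,\<tau>). integral\<^sup>L lborel (\<lambda>(x,t). cis (-(x * \<xi> + t * \<tau>)) * w (x,t)))"

definition japan :: "real \<Rightarrow> real" where
  "japan x = 1 + \<bar>x\<bar>"

definition phi :: "real \<Rightarrow> real \<Rightarrow> real \<Rightarrow> real" where
  "phi \<alpha> \<beta> \<xi> = \<alpha> * \<xi> ^ 3 - \<beta> * \<xi>"

text \<open>Norm of X^{alpha,beta}_{s,b}, evaluated on Schwartz functions (dense subspace).\<close>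
definition Xnorm :: "real \<Rightarrow> real \<Rightarrow> real \<Rightarrow> real \<Rightarrow> (real \<times> real \<Rightarrow> complex) \<Rightarrow> real" where
  "Xnorm \<alpha> \<beta> s b w = sqrt (integral\<^sup>L lborel (\<lambda>(\<xi>,\<tau>).
      (japan \<xi> powr s * japan (\<tau> - phi \<alpha> \<beta> \<xi>) powr b * cmod (fourier2 w (\<xi>,\<tau>))) ^ 2))"

end

theory Submission
  imports Defs "HOL-Probability.Probability" "HOL-Real_Asymp.Real_Asymp"
begin

text \<open>The estimate is tested on Gaussian wave packets \<open>w\<^sub>1\<close>, \<open>w\<^sub>2\<close> with \<open>\<xi>\<close>-width \<open>a\<close>, \<open>\<tau>\<close>-width \<open>1\<close>
  and a common slope \<open>m\<close> in frequency space. The product of two packets is again a packet, so no convolution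
  has to be computed. If the symbols vary slowly over the packets, every norm is its weight at the centre times
  \<open>a\<^sup>-\<^sup>1\<^sup>/\<^sup>2\<close>, and the estimate forces
  \<open>a \<xi>\<^sup>2 W\<^sup>2 \<lesssim> W\<^sub>1\<^sup>2 W\<^sub>2\<^sup>2\<close> for the weights \<open>W, W\<^sub>1, W\<^sub>2\<close> at the three centres, where \<open>\<xi> = \<xi>\<^sub>1 + \<xi>\<^sub>2\<close>.
  Letting \<open>N \<rightarrow> \<infinity>\<close>, this fails
  \<^item> if \<open>s + 3 b < 3/4\<close>, for \<open>(\<xi>\<^sub>1, \<xi>\<^sub>2) = (-N, 2 N)\<close>, \<open>a = N\<^sup>-\<^sup>1\<^sup>/\<^sup>2\<close>, where \<open>w\<^sub>1\<close> and the output lie on the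
    cubic and have the same slope, and \<open>w\<^sub>2\<close> has modulation of size \<open>N\<^sup>3\<close>;
  \<^item> if \<open>3 b > 4 + 2 s\<close>, for \<open>(\<xi>\<^sub>1, \<xi>\<^sub>2) = (N, 1 - N)\<close>, \<open>a = N\<^sup>-\<^sup>2\<close>, with both inputs on their cubics and
    output modulation of size \<open>N\<^sup>3\<close>;
  \<^item> if \<open>3 b > 3 + s\<close>, in the same way for \<open>(\<xi>\<^sub>1, \<xi>\<^sub>2) = (N, N)\<close>.\<close>

section \<open>Schwartz functions and their Fourier transform\<close>

text \<open>Complex polynomials in the two real variables. The inductive form lets closure under
  partial derivatives and the growth bound go by rule induction, without degrees or
  coefficients.\<close>

inductive cpoly :: "(real \<times> real \<Rightarrow> complex) \<Rightarrow> bool" where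
  const: "cpoly (\<lambda>z. c)"
| fst: "cpoly (\<lambda>z. complex_of_real (fst z))"
| snd: "cpoly (\<lambda>z. complex_of_real (snd z))"
| add: "cpoly p \<Longrightarrow> cpoly q \<Longrightarrow> cpoly (\<lambda>z. p z + q z)"
| mult: "cpoly p \<Longrightarrow> cpoly q \<Longrightarrow> cpoly (\<lambda>z. p z * q z)"

lemma cpoly_power: "cpoly p \<Longrightarrow> cpoly (\<lambda>z. p z ^ n)"
  by (induction n) (simp_all add: cpoly.intros)

lemma cpoly_differentiable: "cpoly p \<Longrightarrow> p differentiable (at z)"
proof (induction rule: cpoly.induct)
  case fst
  have "bounded_linear (\<lambda>z::real \<times> real. complex_of_real (fst z))"
    by (rule bounded_linear_compose[OF bounded_linear_of_real bounded_linear_fst])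
  then show ?case using bounded_linear_imp_differentiable by blast
next
  case snd
  have "bounded_linear (\<lambda>z::real \<times> real. complex_of_real (snd z))"
    by (rule bounded_linear_compose[OF bounded_linear_of_real bounded_linear_snd])
  then show ?case using bounded_linear_imp_differentiable by blast
qed auto

lemma cpoly_deriv_x:
  "cpoly p \<Longrightarrow> \<exists>q. cpoly q \<and> (\<forall>x t. ((\<lambda>y. p (y, t)) has_vector_derivative q (x, t)) (at x))"
proof (induction rule: cpoly.induct)
  case (const c)
  show ?case by (intro exI[of _ "\<lambda>z. 0"]) (auto intro: cpoly.const)
next
  case fst
  show ?case
    by (intro exI[of _ "\<lambda>z. 1"])
       (auto intro: cpoly.const has_vector_derivative_of_real[of "\<lambda>y. y" 1, simplified])
next
  case snd
  show ?case by (intro exI[of _ "\<lambda>z. 0"]) (auto intro: cpoly.const)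
next
  case (add p q)
  then obtain p' q' where "cpoly p'" "cpoly q'"
    "\<And>x t. ((\<lambda>y. p (y, t)) has_vector_derivative p' (x, t)) (at x)"
    "\<And>x t. ((\<lambda>y. q (y, t)) has_vector_derivative q' (x, t)) (at x)" by blast
  then show ?case
    by (intro exI[of _ "\<lambda>z. p' z + q' z"]) (auto intro: cpoly.add has_vector_derivative_add)
next
  case (mult p q)
  then obtain p' q' where "cpoly p'" "cpoly q'"
    "\<And>x t. ((\<lambda>y. p (y, t)) has_vector_derivative p' (x, t)) (at x)"
    "\<And>x t. ((\<lambda>y. q (y, t)) has_vector_derivative q' (x, t)) (at x)" by blast
  with mult(1,2) show ?case
    by (intro exI[of _ "\<lambda>z. p z * q' z + p' z * q z"])
       (auto intro!: cpoly.add cpoly.mult has_vector_derivative_mult)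
qed

text \<open>Exchanging the variables turns a t-derivative into an x-derivative, so one induction on
  derivatives is enough.\<close>

lemma cpoly_swap: "cpoly p \<Longrightarrow> cpoly (p \<circ> prod.swap)"
  by (induction rule: cpoly.induct)
     (auto simp: o_def prod.swap_def intro: cpoly.intros)

lemma cpoly_deriv_t:
  assumes "cpoly p"
  shows "\<exists>q. cpoly q \<and> (\<forall>x t. ((\<lambda>s. p (x, s)) has_vector_derivative q (x, t)) (at t))"
proof -
  obtain q where "cpoly q" "\<forall>x t. ((\<lambda>y. (p \<circ> prod.swap) (y, t)) has_vector_derivative q (x, t)) (at x)"
    using cpoly_deriv_x[OF cpoly_swap[OF assms]] by blast
  then show ?thesis by (intro exI[of _ "q \<circ> prod.swap"]) (auto intro: cpoly_swap)
qed

lemma has_vector_derivative_cexp: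
  assumes "(f has_vector_derivative f') (at (x::real))"
  shows "((\<lambda>y. exp (f y :: complex)) has_vector_derivative f' * exp (f x)) (at x)"
  using field_vector_diff_chain_at[OF assms DERIV_exp] by (simp add: o_def)

text \<open>One partial derivative turns q exp L into (q L' + q') exp L, and the new coefficient is
  again polynomial. So polynomial multiples of exp L are stable under all iterated partials.\<close>

lemma partials_cpoly_exp:
  assumes L: "cpoly L"
  shows "cpoly p \<Longrightarrow> \<exists>q. cpoly q \<and> partials ds (\<lambda>z. p z * exp (L z)) = (\<lambda>z. q z * exp (L z))"
proof (induction ds)
  case (Cons d ds)
  then obtain q where q: "cpoly q" "partials ds (\<lambda>z. p z * exp (L z)) = (\<lambda>z. q z * exp (L z))"
    by blast
  show ?case
  proof (cases d)
    case True
    obtain q' L' where D: "cpoly q'" "\<And>x t. ((\<lambda>y. q (y, t)) has_vector_derivative q' (x, t)) (at x)"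
      "cpoly L'" "\<And>x t. ((\<lambda>y. L (y, t)) has_vector_derivative L' (x, t)) (at x)"
      using cpoly_deriv_x[OF q(1)] cpoly_deriv_x[OF L] by blast
    have "((\<lambda>y. q (y, t) * exp (L (y, t))) has_vector_derivative
        (q (x, t) * L' (x, t) + q' (x, t)) * exp (L (x, t))) (at x)" for x t
      using has_vector_derivative_mult[OF D(2)[where x=x and t=t] has_vector_derivative_cexp[OF D(4)[where x=x and t=t]]]
      by (simp add: algebra_simps)
    then have "partial_x (\<lambda>z. q z * exp (L z)) = (\<lambda>z. (q z * L' z + q' z) * exp (L z))"
      by (auto simp: partial_x_def fun_eq_iff intro!: vector_derivative_at)
    moreover have "cpoly (\<lambda>z. q z * L' z + q' z)" using q D by (auto intro: cpoly.intros)
    ultimately show ?thesis using True q(2) 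
      by (intro exI[of _ "\<lambda>z. q z * L' z + q' z"]) simp
  next
    case False
    obtain q' L' where D: "cpoly q'" "\<And>x t. ((\<lambda>s. q (x, s)) has_vector_derivative q' (x, t)) (at t)"
      "cpoly L'" "\<And>x t. ((\<lambda>s. L (x, s)) has_vector_derivative L' (x, t)) (at t)"
      using cpoly_deriv_t[OF q(1)] cpoly_deriv_t[OF L] by blast
    have "((\<lambda>s. q (x, s) * exp (L (x, s))) has_vector_derivative
        (q (x, t) * L' (x, t) + q' (x, t)) * exp (L (x, t))) (at t)" for x t
      using has_vector_derivative_mult[OF D(2)[where x=x and t=t] has_vector_derivative_cexp[OF D(4)[where x=x and t=t]]]
      by (simp add: algebra_simps)
    then have "partial_t (\<lambda>z. q z * exp (L z)) = (\<lambda>z. (q z * L' z + q' z) * exp (L z))"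
      by (auto simp: partial_t_def fun_eq_iff intro!: vector_derivative_at)
    moreover have "cpoly (\<lambda>z. q z * L' z + q' z)" using q D by (auto intro: cpoly.intros)
    ultimately show ?thesis using False q(2) 
      by (intro exI[of _ "\<lambda>z. q z * L' z + q' z"]) simp
  qed
qed auto

text \<open>Completing the square gives |x| \<le> e x^2 + 1/(4e); combine this with |x| \<le> exp
  |x|.\<close>

lemma abs_le_exp_square:
  fixes x e :: real
  assumes "e > 0"
  shows "\<bar>x\<bar> \<le> exp (1 / (4 * e)) * exp (e * x\<^sup>2)"
proof -
  have "0 \<le> (2 * e * \<bar>x\<bar> - 1)\<^sup>2 / (4 * e)" using assms by simp
  also have "\<dots> = e * x\<^sup>2 + 1 / (4 * e) - \<bar>x\<bar>" using assms by (simp add: field_simps power2_eq_square)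
  finally have *: "\<bar>x\<bar> \<le> 1 / (4 * e) + e * x\<^sup>2" by simp
  have "\<bar>x\<bar> \<le> exp \<bar>x\<bar>" using exp_ge_add_one_self[of "\<bar>x\<bar>"] by linarith
  also have "\<dots> \<le> exp (1 / (4 * e) + e * x\<^sup>2)" using * by simp
  finally show ?thesis by (simp add: exp_add)
qed

text \<open>Arbitrarily slow Gaussian growth dominates any polynomial. The rate \<open>e\<close>
  stays arbitrary in the induction because a product spends e/2 on each factor.\<close>

lemma cpoly_bound:
  "cpoly p \<Longrightarrow> e > 0 \<Longrightarrow> \<exists>C\<ge>0. \<forall>x t. cmod (p (x, t)) \<le> C * exp (e * (x\<^sup>2 + t\<^sup>2))"
proof (induction arbitrary: e rule: cpoly.induct)
  case (const c)
  then show ?case by (intro exI[of _ "cmod c"]) (auto intro!: mult_le_cancel_left1[THEN iffD2])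
next
  case fst
  have "\<bar>x\<bar> \<le> exp (1 / (4 * e)) * exp (e * (x\<^sup>2 + t\<^sup>2))" for x t :: real
    by (rule order_trans[OF abs_le_exp_square[OF fst]]) (use fst in simp)
  then show ?case by (intro exI[of _ "exp (1 / (4 * e))"]) simp
next
  case snd
  have "\<bar>t\<bar> \<le> exp (1 / (4 * e)) * exp (e * (x\<^sup>2 + t\<^sup>2))" for x t :: real
    by (rule order_trans[OF abs_le_exp_square[OF snd]]) (use snd in simp)
  then show ?case by (intro exI[of _ "exp (1 / (4 * e))"]) simp
next
  case (add p q)
  obtain A B where "A \<ge> 0" "B \<ge> 0" "\<And>x t. cmod (p (x, t)) \<le> A * exp (e * (x\<^sup>2 + t\<^sup>2))"
     "\<And>x t. cmod (q (x, t)) \<le> B * exp (e * (x\<^sup>2 + t\<^sup>2))" using add.IH add.prems by meson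
  then show ?case
    by (intro exI[of _ "A + B"]) (auto simp: distrib_right intro: order_trans[OF norm_triangle_ineq add_mono])
next
  case (mult p q)
  have "e / 2 > 0" using mult.prems by simp
  then obtain A B where "A \<ge> 0" "B \<ge> 0" and
     A: "\<And>x t. cmod (p (x, t)) \<le> A * exp (e / 2 * (x\<^sup>2 + t\<^sup>2))" and
     B: "\<And>x t. cmod (q (x, t)) \<le> B * exp (e / 2 * (x\<^sup>2 + t\<^sup>2))" using mult.IH by meson
  have "cmod (p (x, t) * q (x, t)) \<le> A * B * exp (e * (x\<^sup>2 + t\<^sup>2))" for x t
  proof -
    have "cmod (p (x, t) * q (x, t)) \<le> (A * exp (e / 2 * (x\<^sup>2 + t\<^sup>2))) * (B * exp (e / 2 * (x\<^sup>2 + t\<^sup>2)))"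
      unfolding norm_mult by (intro mult_mono A B) (use \<open>A \<ge> 0\<close> in auto)
    also have "\<dots> = A * B * (exp (e / 2 * (x\<^sup>2 + t\<^sup>2)) * exp (e / 2 * (x\<^sup>2 + t\<^sup>2)))" by simp
    also have "\<dots> = A * B * exp (e * (x\<^sup>2 + t\<^sup>2))" unfolding exp_add[symmetric] by (simp add: field_simps)
    finally show ?thesis .
  qed
  then show ?case using \<open>A \<ge> 0\<close> \<open>B \<ge> 0\<close> by (intro exI[of _ "A * B"]) auto
qed

text \<open>Every weighted derivative is a polynomial times exp L. With growth rate e = c in
  \<open>cpoly_bound\<close>, the decay of |exp L| cancels the growth exactly and leaves a
  constant.\<close>

lemma schwartz_exp_cpoly:
  assumes L: "cpoly L" and c: "c > 0" and Re: "\<And>x t. Re (L (x, t)) \<le> - c * (x\<^sup>2 + t\<^sup>2)"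
  shows "schwartz (\<lambda>z. exp (L z))"
  unfolding schwartz_def
proof (intro conjI allI)
  fix ds
  obtain q where q: "cpoly q" "partials ds (\<lambda>z. exp (L z)) = (\<lambda>z. q z * exp (L z))"
    using partials_cpoly_exp[OF L cpoly.const[of 1], of ds] by auto
  have "(\<lambda>z. exp (L z)) differentiable (at z)" for z
    using differentiable_chain_at[OF cpoly_differentiable[OF L], of exp z]
    by (simp add: o_def field_differentiable_imp_differentiable field_differentiable_within_exp)
  then show "partials ds (\<lambda>z. exp (L z)) differentiable_on UNIV"
    unfolding q differentiable_on_def using cpoly_differentiable[OF q(1)] by auto
  fix k m :: nat
  have "cpoly (\<lambda>z. complex_of_real (fst z) ^ k * complex_of_real (snd z) ^ m * q z)"
    by (intro cpoly.mult cpoly_power cpoly.fst cpoly.snd q)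
  from cpoly_bound[OF this c] obtain C where C: "C \<ge> 0"
    "\<And>x t. cmod (complex_of_real x ^ k * complex_of_real t ^ m * q (x, t)) \<le> C * exp (c * (x\<^sup>2 + t\<^sup>2))"
    by auto
  have "cmod (complex_of_real (x ^ k * t ^ m) * partials ds (\<lambda>z. exp (L z)) (x, t)) \<le> C" for x t
  proof -
    have "cmod (complex_of_real (x ^ k * t ^ m) * partials ds (\<lambda>z. exp (L z)) (x, t))
        = cmod (complex_of_real x ^ k * complex_of_real t ^ m * q (x, t)) * exp (Re (L (x, t)))"
      unfolding q(2) by (simp add: norm_mult)
    also have "\<dots> \<le> (C * exp (c * (x\<^sup>2 + t\<^sup>2))) * exp (- c * (x\<^sup>2 + t\<^sup>2))"
      by (intro mult_mono C) (use Re C in auto)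
    also have "\<dots> = C" by (simp add: exp_minus)
    finally show ?thesis .
  qed
  then show "bounded (range (\<lambda>(x, t). complex_of_real (x ^ k * t ^ m) * partials ds (\<lambda>z. exp (L z)) (x, t)))"
    by (auto simp: bounded_iff)
qed

section \<open>Decay and integrability of Schwartz functions\<close>

lemma integrable_inverse_one_plus_square: "integrable lborel (\<lambda>x::real. 1 / (1 + x\<^sup>2))"
proof -
  have "set_integrable lborel (einterval (-\<infinity>) \<infinity>) (\<lambda>x::real. 1 / (1 + x\<^sup>2))"
  proof (rule interval_integral_FTC_nonneg(1)[where F=arctan and A="-pi/2" and B="pi/2"])
    show "((arctan \<circ> real_of_ereal) \<longlongrightarrow> - pi / 2) (at_right (-\<infinity>))"
      by (simp add: at_right_MInf filterlim_filtermap o_def tendsto_arctan_at_bot)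
    show "((arctan \<circ> real_of_ereal) \<longlongrightarrow> pi / 2) (at_left \<infinity>)"
      by (simp add: at_left_PInf filterlim_filtermap o_def tendsto_arctan_at_top)
  qed (auto intro!: derivative_eq_intros continuous_intros simp: add_nonneg_eq_0_iff inverse_eq_divide)
  then show ?thesis by (simp add: set_integrable_def einterval_def)
qed

text \<open>The four seminorms with exponents 0 or 2 in each variable add up to a bound for (1 +
  x^2)(1 + t^2)|f|. The majorant is a product, so Fubini and restriction to slices apply to it
  directly.\<close>

lemma schwartz_decay:
  assumes "schwartz f"
  shows "\<exists>C\<ge>0. \<forall>x t. cmod (f (x, t)) \<le> C * (1 / (1 + x\<^sup>2)) * (1 / (1 + t\<^sup>2))"
proof -
  have "\<exists>B. \<forall>x t. cmod (complex_of_real (x ^ k * t ^ m) * f (x, t)) \<le> B" for k m :: nat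
  proof -
    have "bounded (range (\<lambda>(x,t). complex_of_real (x ^ k * t ^ m) * partials [] f (x,t)))"
      using assms unfolding schwartz_def by blast
    then show ?thesis by (auto simp: bounded_iff)
  qed
  then obtain B where B: "\<And>k m x t. cmod (complex_of_real (x ^ k * t ^ m) * f (x, t)) \<le> B k m"
    by metis
  let ?C = "B 0 0 + B 2 0 + B 0 2 + B 2 2"
  have *: "cmod (f (x, t)) * ((1 + x\<^sup>2) * (1 + t\<^sup>2)) \<le> ?C" for x t
    using B[of x 0 t 0] B[of x 2 t 0] B[of x 0 t 2] B[of x 2 t 2]
    by (simp add: norm_mult norm_power algebra_simps)
  have "0 \<le> ?C" using order_trans[OF norm_ge_zero *[of 0 0, simplified]] by simp
  moreover have "cmod (f (x, t)) \<le> ?C * (1 / (1 + x\<^sup>2)) * (1 / (1 + t\<^sup>2))" for x t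
  proof -
    have "0 < (1 + x\<^sup>2) * (1 + t\<^sup>2)" by (simp add: add_pos_nonneg)
    from *[of x t, folded pos_le_divide_eq[OF this]] show ?thesis by simp
  qed
  ultimately show ?thesis by blast
qed

lemma schwartz_partial_x: "schwartz f \<Longrightarrow> schwartz (partial_x f)"
proof -
  \<comment> \<open>The head of the list is the derivative applied last, so the extra x-derivative
    is appended at the end.\<close>
  have "partials ds (partial_x f) = partials (ds @ [True]) f" for ds
    by (induction ds) auto
  then show "schwartz f \<Longrightarrow> schwartz (partial_x f)" unfolding schwartz_def by simp
qed

lemma schwartz_continuous: "schwartz f \<Longrightarrow> continuous_on UNIV f"
  unfolding schwartz_def using differentiable_imp_continuous_on partials.simps(1) by metis

lemma schwartz_borel_measurable [measurable_dest]: "schwartz f \<Longrightarrow> f \<in> borel_measurable borel"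
  using schwartz_continuous borel_measurable_continuous_onI by blast

lemma integrable_lborel_Times_bound:
  fixes f :: "real \<times> real \<Rightarrow> complex"
  assumes [measurable]: "f \<in> borel_measurable borel"
    and g: "integrable lborel g" and h: "integrable lborel h" and nn: "\<And>t. 0 \<le> h t"
    and le: "\<And>x t. cmod (f (x, t)) \<le> g x * h t"
  shows "integrable lborel f"
proof (rule Bochner_Integration.integrable_bound)
  have [measurable]: "g \<in> borel_measurable borel" "h \<in> borel_measurable borel"
    using g h by auto
  have "integrable (lborel \<Otimes>\<^sub>M lborel) (\<lambda>(x, t). g x * h t)"
    by (rule lborel_pair.Fubini_integrable) (auto simp: g h abs_mult)
  then show "integrable lborel (\<lambda>(x, t). g x * h t)" by (simp add: lborel_prod)
  show "AE z in lborel. norm (f z) \<le> norm (case z of (x, t) \<Rightarrow> g x * h t)"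
    by (intro AE_I2) (auto intro: order_trans[OF le])
qed auto

lemma schwartz_integrable:
  assumes "schwartz f" shows "integrable lborel f"
proof -
  obtain C where "\<And>x t. cmod (f (x, t)) \<le> C * (1 / (1 + x\<^sup>2)) * (1 / (1 + t\<^sup>2))"
    using schwartz_decay[OF assms] by blast
  moreover have "integrable lborel (\<lambda>x::real. C * (1 / (1 + x\<^sup>2)))"
    by (intro integrable_mult_right integrable_inverse_one_plus_square)
  ultimately show ?thesis using assms
    by (intro integrable_lborel_Times_bound[where g="\<lambda>x. C * (1 / (1 + x\<^sup>2))" and h="\<lambda>t. 1 / (1 + t\<^sup>2)"])
       (auto intro: integrable_inverse_one_plus_square schwartz_borel_measurable)
qed

lemma schwartz_integrable_slice:
  assumes "schwartz f" shows "integrable lborel (\<lambda>x. f (x, t))"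
proof -
  obtain C where C: "C \<ge> 0" "\<And>x t. cmod (f (x, t)) \<le> C * (1 / (1 + x\<^sup>2)) * (1 / (1 + t\<^sup>2))"
    using schwartz_decay[OF assms] by blast
  note [measurable] = schwartz_borel_measurable[OF assms]
  have "integrable lborel (\<lambda>x::real. (C * (1 / (1 + t\<^sup>2))) * (1 / (1 + x\<^sup>2)))"
    by (intro integrable_mult_right integrable_inverse_one_plus_square)
  then show ?thesis
    by (rule Bochner_Integration.integrable_bound) (use C in \<open>auto simp: mult_ac\<close>)
qed

section \<open>The Fourier transform of an x-derivative\<close>

lemma schwartz_slice_has_vector_derivative:
  assumes "schwartz f"
  shows "((\<lambda>y. f (y, t)) has_vector_derivative partial_x f (x, t)) (at x)"
proof -
  have "partials [] f differentiable_on UNIV" using assms unfolding schwartz_def by blast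
  then have "f differentiable (at (x, t))" by (auto simp: differentiable_on_def)
  moreover have "((\<lambda>y. (y, t)) has_derivative (\<lambda>h. (h, 0))) (at x)"
    by (intro has_derivative_Pair has_derivative_ident has_derivative_const)
  then have "(\<lambda>y. (y, t)) differentiable (at x)"
    by (auto simp: differentiable_def)
  ultimately have "(\<lambda>y. f (y, t)) differentiable (at x)"
    using differentiable_chain_at[of "\<lambda>y. (y, t)" x f] by (simp add: o_def)
  then show ?thesis by (simp add: partial_x_def vector_derivative_works)
qed

lemma schwartz_slice_tendsto_0:
  assumes "schwartz f"
  shows "((\<lambda>x. f (x, t)) \<longlongrightarrow> 0) at_infinity"
proof -
  obtain C where C: "C \<ge> 0" "\<And>x t. cmod (f (x, t)) \<le> C * (1 / (1 + x\<^sup>2)) * (1 / (1 + t\<^sup>2))"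
    using schwartz_decay[OF assms] by blast
  have "((\<lambda>x. C * (1 / (1 + x\<^sup>2)) * (1 / (1 + t\<^sup>2))) \<longlongrightarrow> 0) at_infinity"
    unfolding at_infinity_eq_at_top_bot
    by (intro filterlim_sup tendsto_mult_left_zero tendsto_mult_right_zero) real_asymp+
  then show ?thesis
    by (rule Lim_null_comparison[rotated]) (use C in auto)
qed

text \<open>The x-integral is placed inside because both uses begin with x at fixed t: integration
  by parts, and the Gaussian whose centre in x moves with t.\<close>

lemma fourier2_iterated:
  assumes "schwartz f"
  shows "fourier2 f (\<xi>, \<tau>) = (LBINT t. LBINT x. cis (-(x * \<xi> + t * \<tau>)) * f (x, t))"
proof -
  note [measurable] = schwartz_borel_measurable[OF assms]
  have [measurable]: "(\<lambda>z. cis (-(fst z * \<xi> + snd z * \<tau>))) \<in> borel_measurable borel"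
    by (intro borel_measurable_continuous_onI continuous_intros)
  have "(\<lambda>z. cis (-(fst z * \<xi> + snd z * \<tau>)) * f z) \<in> borel_measurable borel"
    by measurable
  then have "integrable lborel (\<lambda>z. cis (-(fst z * \<xi> + snd z * \<tau>)) * f z)"
    by (intro Bochner_Integration.integrable_bound[OF schwartz_integrable[OF assms]])
       (auto simp: norm_mult)
  then have "integrable lborel (\<lambda>(x, t). cis (-(x * \<xi> + t * \<tau>)) * f (x, t))"
    by (simp add: split_def)
  then show ?thesis unfolding fourier2_def
    by (subst (asm) lborel_prod[symmetric], subst lborel_prod[symmetric])
       (simp add: lborel_pair.integral_snd)
qed

lemma integral_deriv_eq_0:
  fixes F f :: "real \<Rightarrow> complex"
  assumes "\<And>x. (F has_vector_derivative f x) (at x)" "\<And>x. isCont f x" "integrable lborel f"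
    and lim: "(F \<longlongrightarrow> 0) at_infinity"
  shows "integral\<^sup>L lborel f = 0"
proof -
  have "(LBINT x=-\<infinity>..\<infinity>. f x) = 0 - 0"
  proof (rule interval_integral_FTC_integrable[where F=F])
    show "((F \<circ> real_of_ereal) \<longlongrightarrow> 0) (at_right (-\<infinity>))"
      unfolding at_right_MInf filterlim_filtermap
      by (auto simp: o_def at_infinity_eq_at_top_bot intro: filterlim_mono[OF lim order_refl])
    show "((F \<circ> real_of_ereal) \<longlongrightarrow> 0) (at_left \<infinity>)"
      unfolding at_left_PInf filterlim_filtermap
      by (auto simp: o_def at_infinity_eq_at_top_bot intro: filterlim_mono[OF lim order_refl])
  qed (use assms in \<open>auto simp: set_integrable_def einterval_def\<close>)
  then show ?thesis by (simp add: interval_integral_to_infinity_eq interval_lebesgue_integral_def einterval_def set_lebesgue_integral_def)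
qed

text \<open>Integration by parts in x at fixed t: the integrand \<open>?h\<close> is the derivative
  of the oscillating factor times f, and it integrates to 0 because f vanishes at infinity.\<close>

lemma fourier2_partial_x:
  assumes f: "schwartz f"
  shows "fourier2 (partial_x f) (\<xi>, \<tau>) = \<i> * \<xi> * fourier2 f (\<xi>, \<tau>)"
proof -
  have "(LBINT x. cis (-(x * \<xi> + t * \<tau>)) * partial_x f (x, t))
      = \<i> * \<xi> * (LBINT x. cis (-(x * \<xi> + t * \<tau>)) * f (x, t))" for t
  proof -
    have i: "integrable lborel (\<lambda>x. cis (-(x * \<xi> + t * \<tau>)) * g (x, t))" if g: "schwartz g" for g
    proof (rule Bochner_Integration.integrable_bound[OF schwartz_integrable_slice[OF g, of t]])
      note [measurable] = schwartz_borel_measurable[OF g]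
      have [measurable]: "(\<lambda>x. cis (-(x * \<xi> + t * \<tau>))) \<in> borel_measurable borel"
        by (intro borel_measurable_continuous_onI continuous_intros)
      show "(\<lambda>x. cis (-(x * \<xi> + t * \<tau>)) * g (x, t)) \<in> borel_measurable lborel" by measurable
    qed (simp add: norm_mult)
    let ?h = "\<lambda>x. cis (-(x * \<xi> + t * \<tau>)) * partial_x f (x, t)
                 + (- (\<i> * \<xi>)) * (cis (-(x * \<xi> + t * \<tau>)) * f (x, t))"
    have c: "((\<lambda>x. cis (-(x * \<xi> + t * \<tau>))) has_vector_derivative
          (- (\<i> * \<xi>)) * cis (-(x * \<xi> + t * \<tau>))) (at x)" for x
    proof -
      have "((\<lambda>x. -(x * \<xi> + t * \<tau>)) has_real_derivative - \<xi>) (at x)"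
        by (auto intro!: derivative_eq_intros)
      from has_vector_derivative_cexp[OF has_vector_derivative_mult_right[OF has_vector_derivative_of_real[OF this], of \<i>]]
      show ?thesis by (simp add: cis_conv_exp)
    qed
    have cc: "isCont (\<lambda>x. cis (-(x * \<xi> + t * \<tau>))) x" for x
      by (rule has_vector_derivative_continuous[OF c])
    have cont: "isCont (\<lambda>x. g (x, t)) x" if "schwartz g" for g x
      using schwartz_continuous[OF that]
      by (intro continuous_within_compose3[where g=g and f="\<lambda>x. (x, t)"])
         (auto simp: continuous_on_eq_continuous_at intro!: continuous_intros)
    have I1: "integrable lborel (\<lambda>x. cis (-(x * \<xi> + t * \<tau>)) * partial_x f (x, t))"
      by (rule i[OF schwartz_partial_x[OF f]])
    have I2: "integrable lborel (\<lambda>x. (- (\<i> * \<xi>)) * (cis (-(x * \<xi> + t * \<tau>)) * f (x, t)))"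
      using i[OF f] by simp
    have "((\<lambda>x. cis (-(x * \<xi> + t * \<tau>)) * f (x, t)) has_vector_derivative ?h x) (at x)" for x
      using has_vector_derivative_mult[OF c schwartz_slice_has_vector_derivative[OF f, of t x]]
      by (simp add: algebra_simps)
    moreover have "isCont ?h x" for x
      by (intro isCont_add isCont_mult cc cont[OF f] cont[OF schwartz_partial_x[OF f]] continuous_const)
    moreover have "integrable lborel ?h"
      by (rule Bochner_Integration.integrable_add[OF I1 I2])
    moreover have "((\<lambda>x. cis (-(x * \<xi> + t * \<tau>)) * f (x, t)) \<longlongrightarrow> 0) at_infinity"
      by (rule tendsto_norm_zero_cancel)
         (use schwartz_slice_tendsto_0[OF f, of t, THEN tendsto_norm_zero] in \<open>simp add: norm_mult\<close>)
    ultimately have "integral\<^sup>L lborel ?h = 0" by (rule integral_deriv_eq_0)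
    also have "integral\<^sup>L lborel ?h = (LBINT x. cis (-(x * \<xi> + t * \<tau>)) * partial_x f (x, t))
      + (- (\<i> * \<xi>)) * (LBINT x. cis (-(x * \<xi> + t * \<tau>)) * f (x, t))"
      unfolding Bochner_Integration.integral_add[OF I1 I2] by simp
    finally show ?thesis by (simp add: algebra_simps)
  qed
  then show ?thesis
    by (simp add: fourier2_iterated f schwartz_partial_x)
qed

section \<open>Gaussian wave packets\<close>

text \<open>A modulated Gaussian in the sheared variables x + m t and t. The parameters
  \<open>a\<close> and \<open>d\<close> are widths on the Fourier side: the transform is a Gaussian
  centred at (\<xi>0, \<tau>0), of width a in \<xi> and width d in \<tau> about the line of slope m
  through the centre.\<close>

definition packet :: "real \<Rightarrow> real \<Rightarrow> real \<Rightarrow> real \<Rightarrow> real \<Rightarrow> real \<times> real \<Rightarrow> complex" where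
  "packet a d m \<xi>\<^sub>0 \<tau>\<^sub>0 = (\<lambda>(x, t). exp (Complex (- ((a * (x + m * t))\<^sup>2 + (d * t)\<^sup>2) / 2) (x * \<xi>\<^sub>0 + t * \<tau>\<^sub>0)))"

text \<open>Writing x = (x + m t) - m t gives x^2 \<le> 2 (x + m t)^2 + 2 m^2 t^2. This provides the
  Gaussian decay needed for packets to be Schwartz functions.\<close>

lemma sheared_form_coercive:
  fixes a d m :: real
  assumes "a > 0" "d > 0"
  shows "\<exists>c>0. \<forall>x t. c * (x\<^sup>2 + t\<^sup>2) \<le> (a * (x + m * t))\<^sup>2 + (d * t)\<^sup>2"
proof -
  define K where "K = 2 / a\<^sup>2 + (2 * m\<^sup>2 + 1) / d\<^sup>2"
  have K: "K > 0" using assms by (simp add: K_def add_pos_nonneg)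
  have "x\<^sup>2 + t\<^sup>2 \<le> K * ((a * (x + m * t))\<^sup>2 + (d * t)\<^sup>2)" for x t
  proof -
    have "0 \<le> ((x + m * t) + m * t)\<^sup>2" by simp
    then have "x\<^sup>2 + t\<^sup>2 \<le> 2 * (x + m * t)\<^sup>2 + (2 * m\<^sup>2 + 1) * t\<^sup>2"
      by (simp add: power2_eq_square algebra_simps)
    also have "\<dots> = 2 / a\<^sup>2 * (a * (x + m * t))\<^sup>2 + (2 * m\<^sup>2 + 1) / d\<^sup>2 * (d * t)\<^sup>2"
      using assms by (simp add: power_mult_distrib)
    also have "\<dots> \<le> K * (a * (x + m * t))\<^sup>2 + K * (d * t)\<^sup>2"
      using assms by (intro add_mono mult_right_mono) (auto simp: K_def)
    finally show ?thesis by (simp add: distrib_left)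
  qed
  then show ?thesis using K
    by (intro exI[of _ "1 / K"]) (simp add: field_simps)
qed

lemma schwartz_packet:
  assumes "a > 0" "d > 0"
  shows "schwartz (packet a d m \<xi>\<^sub>0 \<tau>\<^sub>0)"
proof -
  define L where "L = (\<lambda>z::real\<times>real. Complex (- ((a * (fst z + m * snd z))\<^sup>2 + (d * snd z)\<^sup>2) / 2) (fst z * \<xi>\<^sub>0 + snd z * \<tau>\<^sub>0))"
  obtain c where c: "c > 0" "\<And>x t. c * (x\<^sup>2 + t\<^sup>2) \<le> (a * (x + m * t))\<^sup>2 + (d * t)\<^sup>2"
    using sheared_form_coercive[OF assms] by blast
  have L: "L = (\<lambda>z. (-1 / 2) * ((complex_of_real a * (of_real (fst z) + of_real m * of_real (snd z)))\<^sup>2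
      + (complex_of_real d * of_real (snd z))\<^sup>2)
      + \<i> * (of_real (fst z) * of_real \<xi>\<^sub>0 + of_real (snd z) * of_real \<tau>\<^sub>0))"
    by (auto simp: L_def complex_eq_iff fun_eq_iff add_divide_distrib
      simp flip: of_real_power of_real_mult of_real_add)
  have "cpoly L"
    unfolding L by (intro cpoly.add cpoly.mult cpoly_power cpoly.const cpoly.fst cpoly.snd)
  moreover have "Re (L (x, t)) \<le> - (c / 2) * (x\<^sup>2 + t\<^sup>2)" for x t
    using c(2)[of x t] by (simp add: L_def)
  ultimately have "schwartz (\<lambda>z. exp (L z))"
    using c(1) by (intro schwartz_exp_cpoly[where c="c / 2"]) auto
  moreover have "(\<lambda>z. exp (L z)) = packet a d m \<xi>\<^sub>0 \<tau>\<^sub>0"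
    by (simp add: L_def packet_def split_def)
  ultimately show ?thesis by simp
qed

text \<open>Both factors have the same quadratic form, so it doubles, which scales each width by
  sqrt 2, while the phases add. This is why the two inputs share a, d and m.\<close>

lemma packet_mult:
  "packet a d m \<xi>\<^sub>1 \<tau>\<^sub>1 z * packet a d m \<xi>\<^sub>2 \<tau>\<^sub>2 z
     = packet (sqrt 2 * a) (sqrt 2 * d) m (\<xi>\<^sub>1 + \<xi>\<^sub>2) (\<tau>\<^sub>1 + \<tau>\<^sub>2) z"
proof (cases z)
  case (Pair x t)
  have "(sqrt 2 * a * (x + m * t))\<^sup>2 = 2 * (a * (x + m * t))\<^sup>2" "(sqrt 2 * d * t)\<^sup>2 = 2 * (d * t)\<^sup>2"
    by (simp_all add: power_mult_distrib)
  then show ?thesis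
    unfolding Pair packet_def split exp_add[symmetric]
    by (intro arg_cong[of _ _ exp]) (simp add: complex_eq_iff algebra_simps)
qed

text \<open>The characteristic function of the standard normal distribution is the case a = 1; the
  substitution y = a x gives the general one.\<close>

lemma gaussian_fourier:
  fixes a \<eta> :: real
  assumes "a > 0"
  shows "(LBINT x. cis (- (x * \<eta>)) * exp (- (a * x)\<^sup>2 / 2)) = complex_of_real (sqrt (2 * pi) / a * exp (- (\<eta> / a)\<^sup>2 / 2))"
proof -
  have *: "(LBINT y. cis (t * y) * exp (- y\<^sup>2 / 2)) = complex_of_real (sqrt (2 * pi) * exp (- t\<^sup>2 / 2))" for t :: real
  proof -
    have "complex_of_real (exp (- t\<^sup>2 / 2)) = char std_normal_distribution t"
      by (simp add: char_std_normal_distribution)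
    also have "\<dots> = (LBINT y. std_normal_density y *\<^sub>R cis (t * y))"
      unfolding char_def by (subst integral_density) (auto simp: cis_conv_exp)
    also have "\<dots> = (LBINT y. (1 / complex_of_real (sqrt (2 * pi))) * (cis (t * y) * exp (- y\<^sup>2 / 2)))"
      by (intro Bochner_Integration.integral_cong) (auto simp: normal_density_def scaleR_conv_of_real)
    also have "\<dots> = (1 / complex_of_real (sqrt (2 * pi))) * (LBINT y. cis (t * y) * exp (- y\<^sup>2 / 2))"
      by (rule integral_mult_right_zero)
    finally show ?thesis by (simp add: field_simps)
  qed
  have "(LBINT y. cis (- \<eta> / a * y) * exp (- y\<^sup>2 / 2)) = a *\<^sub>R (LBINT x. cis (- (x * \<eta>)) * exp (- (a * x)\<^sup>2 / 2))"
    using assms by (subst lborel_integral_real_affine[where c=a and t=0]) (auto simp: mult.commute)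
  with *[of "- \<eta> / a"] assms show ?thesis by (simp add: scaleR_conv_of_real field_simps)
qed

lemma fourier2_packet:
  assumes "a > 0" "d > 0"
  shows "fourier2 (packet a d m \<xi>\<^sub>0 \<tau>\<^sub>0) (\<xi>, \<tau>) = complex_of_real
    (2 * pi / (a * d) * exp (- (((\<xi> - \<xi>\<^sub>0) / a)\<^sup>2 + ((\<tau> - \<tau>\<^sub>0 - m * (\<xi> - \<xi>\<^sub>0)) / d)\<^sup>2) / 2))"
proof -
  let ?c = "complex_of_real (sqrt (2 * pi) / a * exp (- ((\<xi> - \<xi>\<^sub>0) / a)\<^sup>2 / 2))"
  let ?k = "\<lambda>t. cis (- (t * (\<tau> - \<tau>\<^sub>0 - m * (\<xi> - \<xi>\<^sub>0)))) * exp (- (d * t)\<^sup>2 / 2)"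
  have inner: "(LBINT x. cis (-(x * \<xi> + t * \<tau>)) * packet a d m \<xi>\<^sub>0 \<tau>\<^sub>0 (x, t)) = ?c * ?k t" for t
  proof -
    \<comment> \<open>The shift x = y - m t decouples the quadratic form. It leaves behind the phase
      m t (\<xi> - \<xi>0), which tilts the packet to slope m in frequency space.\<close>
    have eq: "cis (-((- m * t + y) * \<xi> + t * \<tau>)) * packet a d m \<xi>\<^sub>0 \<tau>\<^sub>0 (- m * t + y, t)
        = ?k t * (cis (- (y * (\<xi> - \<xi>\<^sub>0))) * exp (- (a * y)\<^sup>2 / 2))" for y
      unfolding packet_def split cis_conv_exp exp_of_real[symmetric] exp_add[symmetric]
      by (intro arg_cong[of _ _ exp]) (simp add: complex_eq_iff algebra_simps add_divide_distrib diff_divide_distrib)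
    have "(LBINT x. cis (-(x * \<xi> + t * \<tau>)) * packet a d m \<xi>\<^sub>0 \<tau>\<^sub>0 (x, t))
        = (LBINT y. cis (-((- m * t + y) * \<xi> + t * \<tau>)) * packet a d m \<xi>\<^sub>0 \<tau>\<^sub>0 (- m * t + y, t))"
      by (subst lborel_integral_real_affine[where c=1 and t="- m * t"]) auto
    also have "\<dots> = ?k t * (LBINT y. cis (- (y * (\<xi> - \<xi>\<^sub>0))) * exp (- (a * y)\<^sup>2 / 2))"
      unfolding eq by (rule integral_mult_right_zero)
    also have "\<dots> = ?k t * ?c" unfolding gaussian_fourier[OF assms(1)] ..
    finally show ?thesis by (simp only: mult.commute)
  qed
  have "fourier2 (packet a d m \<xi>\<^sub>0 \<tau>\<^sub>0) (\<xi>, \<tau>) = ?c * (LBINT t. ?k t)"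
    unfolding fourier2_iterated[OF schwartz_packet[OF assms]] inner by (rule integral_mult_right_zero)
  also have "(LBINT t. ?k t) = complex_of_real (sqrt (2 * pi) / d * exp (- ((\<tau> - \<tau>\<^sub>0 - m * (\<xi> - \<xi>\<^sub>0)) / d)\<^sup>2 / 2))"
    by (rule gaussian_fourier[OF assms(2)])
  also have "?c * \<dots> = complex_of_real ((sqrt (2 * pi) * sqrt (2 * pi)) / (a * d) *
      (exp (- ((\<xi> - \<xi>\<^sub>0) / a)\<^sup>2 / 2) * exp (- ((\<tau> - \<tau>\<^sub>0 - m * (\<xi> - \<xi>\<^sub>0)) / d)\<^sup>2 / 2)))"
    unfolding of_real_mult[symmetric] by (rule arg_cong[of _ _ complex_of_real]) (simp add: field_simps)
  also have "\<dots> = complex_of_real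
    (2 * pi / (a * d) * exp (- (((\<xi> - \<xi>\<^sub>0) / a)\<^sup>2 + ((\<tau> - \<tau>\<^sub>0 - m * (\<xi> - \<xi>\<^sub>0)) / d)\<^sup>2) / 2))"
    unfolding exp_add[symmetric] by (simp add: field_simps)
  finally show ?thesis .
qed

section \<open>Change of variables to packet coordinates\<close>

lemma borel_measurable_fst_pair [measurable (raw)]:
  "g \<in> borel_measurable M \<Longrightarrow> (\<lambda>x. fst (g x :: real \<times> real)) \<in> borel_measurable M"
  by (rule measurable_compose[OF _ borel_measurable_continuous_onI]) (auto intro!: continuous_intros)

lemma borel_measurable_snd_pair [measurable (raw)]:
  "g \<in> borel_measurable M \<Longrightarrow> (\<lambda>x. snd (g x :: real \<times> real)) \<in> borel_measurable M"
  by (rule measurable_compose[OF _ borel_measurable_continuous_onI]) (auto intro!: continuous_intros)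

text \<open>By Tonelli this is two one-dimensional affine substitutions: the shear m a u depends
  only on the outer variable, so it is a constant shift of the inner one. In the coordinates (u, v)
  every packet becomes the same standard Gaussian, up to a factor.\<close>

lemma nn_integral_shear:
  fixes f :: "real \<times> real \<Rightarrow> ennreal"
  assumes [measurable]: "f \<in> borel_measurable borel" and "a > 0" "d > 0"
  shows "(\<integral>\<^sup>+z. f z \<partial>lborel)
    = ennreal (a * d) * (\<integral>\<^sup>+z. f (x\<^sub>0 + a * fst z, y\<^sub>0 + m * (a * fst z) + d * snd z) \<partial>lborel)"
proof -
  have tonelli: "(\<integral>\<^sup>+z. g z \<partial>lborel) = (\<integral>\<^sup>+x. \<integral>\<^sup>+y. g (x, y) \<partial>lborel \<partial>lborel)"
    if "g \<in> borel_measurable borel" for g :: "real \<times> real \<Rightarrow> ennreal"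
    using that by (subst lborel_prod[symmetric], subst lborel.nn_integral_fst) (auto simp: lborel_prod)
  have "(\<integral>\<^sup>+z. f z \<partial>lborel) = (\<integral>\<^sup>+x. \<integral>\<^sup>+y. f (x, y) \<partial>lborel \<partial>lborel)"
    by (rule tonelli) simp
  also have "\<dots> = ennreal a * (\<integral>\<^sup>+u. \<integral>\<^sup>+y. f (x\<^sub>0 + a * u, y) \<partial>lborel \<partial>lborel)"
    using assms by (subst nn_integral_real_affine[where c=a and t=x\<^sub>0]) auto
  also have "(\<lambda>u. \<integral>\<^sup>+y. f (x\<^sub>0 + a * u, y) \<partial>lborel)
      = (\<lambda>u. ennreal d * (\<integral>\<^sup>+v. f (x\<^sub>0 + a * u, y\<^sub>0 + m * (a * u) + d * v) \<partial>lborel))"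
    using assms by (intro ext, subst nn_integral_real_affine[where c=d]) auto
  also have "ennreal a * (\<integral>\<^sup>+u. ennreal d * (\<integral>\<^sup>+v. f (x\<^sub>0 + a * u, y\<^sub>0 + m * (a * u) + d * v) \<partial>lborel) \<partial>lborel)
    = ennreal (a * d) * (\<integral>\<^sup>+u. \<integral>\<^sup>+v. f (x\<^sub>0 + a * u, y\<^sub>0 + m * (a * u) + d * v) \<partial>lborel \<partial>lborel)"
    using assms by (subst nn_integral_cmult) (auto simp: ennreal_mult mult.assoc)
  also have "(\<integral>\<^sup>+u. \<integral>\<^sup>+v. f (x\<^sub>0 + a * u, y\<^sub>0 + m * (a * u) + d * v) \<partial>lborel \<partial>lborel)
     = (\<integral>\<^sup>+z. f (x\<^sub>0 + a * fst z, y\<^sub>0 + m * (a * fst z) + d * snd z) \<partial>lborel)"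
    by (subst tonelli) auto
  finally show ?thesis .
qed

section \<open>Variation of the weights over a packet\<close>

lemma japan_ge_1: "1 \<le> japan x" by (simp add: japan_def)

lemma japan_pos: "0 < japan x" using japan_ge_1[of x] by linarith

lemma japan_le: "japan x \<le> japan y + \<bar>x - y\<bar>" by (simp add: japan_def)

text \<open>The exponents s and b can have either sign: p \<ge> 0 uses the upper bound for A, and p
  < 0 uses the lower one.\<close>

lemma powr_sandwich:
  fixes A B G p :: real
  assumes "0 < A" "0 < B" "1 \<le> G" "A \<le> G * B" "B \<le> G * A"
  shows "A powr p \<le> G powr \<bar>p\<bar> * B powr p"
proof (cases "p \<ge> 0")
  case True
  then have "A powr p \<le> (G * B) powr p" using assms by (intro powr_mono2) auto
  then show ?thesis using True assms by (simp add: powr_mult)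
next
  case False
  have "A powr p \<le> (B / G) powr p"
    using assms False by (intro powr_mono2') (auto simp: field_simps)
  then show ?thesis using False assms by (simp add: powr_divide powr_minus field_simps)
qed

text \<open>The displacement is at most \<open>japan y\<close> / 2 + M^2 E^2 / 2. The first part is
  smaller than \<open>japan y\<close> and can be absorbed on either side; the second costs only a
  factor independent of the size of y.\<close>

lemma japan_sandwich:
  assumes "\<bar>x - y\<bar> \<le> M * sqrt (japan y) * E" "M \<ge> 0" "E \<ge> 1"
  shows "japan x \<le> (2 + M\<^sup>2) * E\<^sup>2 * japan y" "japan y \<le> (2 + M\<^sup>2) * E\<^sup>2 * japan x"
proof -
  define S where "S = sqrt (japan y)"
  have S: "S \<ge> 1" "S\<^sup>2 = japan y" using japan_ge_1[of y] by (auto simp: S_def)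
  have S2: "1 \<le> S\<^sup>2" using S(1) by (rule one_le_power)
  have E2: "1 \<le> E\<^sup>2" using assms by simp
  have "0 \<le> (S - M * E)\<^sup>2" by simp
  then have am: "M * S * E \<le> S\<^sup>2 / 2 + M\<^sup>2 * E\<^sup>2 / 2" by (simp add: power2_eq_square algebra_simps)
  have xy: "\<bar>x - y\<bar> \<le> S\<^sup>2 / 2 + M\<^sup>2 * E\<^sup>2 / 2" using assms(1) am unfolding S_def by linarith
  have "japan x \<le> 3/2 * S\<^sup>2 + M\<^sup>2 * E\<^sup>2 / 2" using japan_le[of x y] xy S by linarith
  also have "\<dots> \<le> 2 * (E\<^sup>2 * S\<^sup>2) + M\<^sup>2 * (E\<^sup>2 * S\<^sup>2)"
  proof (rule add_mono)
    have "1 * S\<^sup>2 \<le> E\<^sup>2 * S\<^sup>2" by (rule mult_right_mono[OF E2]) simp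
    then show "3/2 * S\<^sup>2 \<le> 2 * (E\<^sup>2 * S\<^sup>2)" using zero_le_power2[of S] by linarith
    have "E\<^sup>2 * 1 \<le> E\<^sup>2 * S\<^sup>2" by (rule mult_left_mono[OF S2]) simp
    then have "M\<^sup>2 * (E\<^sup>2 * 1) \<le> M\<^sup>2 * (E\<^sup>2 * S\<^sup>2)" by (rule mult_left_mono) simp
    moreover have "0 \<le> M\<^sup>2 * (E\<^sup>2 * S\<^sup>2)" by simp
    ultimately show "M\<^sup>2 * E\<^sup>2 / 2 \<le> M\<^sup>2 * (E\<^sup>2 * S\<^sup>2)" by linarith
  qed
  finally show "japan x \<le> (2 + M\<^sup>2) * E\<^sup>2 * japan y" using S by (simp add: algebra_simps)
  have "japan y \<le> japan x + \<bar>x - y\<bar>" using japan_le[of y x] by (simp add: abs_minus_commute)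
  with xy S have "japan y \<le> 2 * japan x + M\<^sup>2 * E\<^sup>2" by linarith
  also have "\<dots> \<le> 2 * (E\<^sup>2 * japan x) + M\<^sup>2 * (E\<^sup>2 * japan x)"
  proof (rule add_mono)
    show "2 * japan x \<le> 2 * (E\<^sup>2 * japan x)" using mult_right_mono[OF E2, of "japan x"] japan_pos[of x] by simp
    have "E\<^sup>2 * 1 \<le> E\<^sup>2 * japan x" using japan_ge_1 by (intro mult_left_mono) auto
    from mult_left_mono[OF this, of "M\<^sup>2"] show "M\<^sup>2 * E\<^sup>2 \<le> M\<^sup>2 * (E\<^sup>2 * japan x)" by simp
  qed
  finally show "japan y \<le> (2 + M\<^sup>2) * E\<^sup>2 * japan x" by (simp add: algebra_simps)
qed

definition weight :: "real \<Rightarrow> real \<Rightarrow> real \<Rightarrow> real \<Rightarrow> real \<Rightarrow> real \<Rightarrow> real" where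
  "weight \<alpha> \<beta> s b \<xi> \<tau> = japan \<xi> powr s * japan (\<tau> - phi \<alpha> \<beta> \<xi>) powr b"

text \<open>The last two conditions bound the variation of \<open>\<tau> - phi \<alpha> \<beta> \<xi>\<close> over the packet by the square root of its
  central value, not by a constant: with \<open>2 * x * y \<le> x\<^sup>2 + y\<^sup>2\<close> the excess can be absorbed into the Gaussian tails.
  This covers the input of modulation \<open>N\<^sup>3\<close>, whose packet is not aligned with its own cubic.\<close>

definition adapted :: "real \<Rightarrow> real \<Rightarrow> real \<Rightarrow> real \<Rightarrow> real \<Rightarrow> real \<Rightarrow> real \<Rightarrow> real \<Rightarrow> bool" where
  "adapted M \<alpha> \<beta> a d m \<xi>\<^sub>0 \<tau>\<^sub>0 \<longleftrightarrow> 0 < a \<and> a \<le> 1 \<and> 0 < d \<and> d \<le> M \<and> \<bar>\<alpha>\<bar> \<le> M \<and> \<bar>\<alpha>\<bar> * \<bar>\<xi>\<^sub>0\<bar> * a\<^sup>2 \<le> M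
     \<and> \<bar>m - (3 * \<alpha> * \<xi>\<^sub>0\<^sup>2 - \<beta>)\<bar> * a \<le> M * sqrt (japan (\<tau>\<^sub>0 - phi \<alpha> \<beta> \<xi>\<^sub>0))"

lemma weight_pos: "0 < weight \<alpha> \<beta> s b \<xi> \<tau>"
  using japan_pos by (simp add: weight_def less_imp_neq[THEN not_sym])

text \<open>The loss \<open>Q\<close> depends on the packet only through M, and it is exponential in
  |u| + |v|, hence beaten by the Gaussian. The first inequality serves the upper bounds for the
  inputs, the second the lower bound for the output.\<close>

lemma weight_sandwich:
  fixes a d m u v s b :: real
  assumes ad: "adapted M \<alpha> \<beta> a d m \<xi>\<^sub>0 \<tau>\<^sub>0"
  defines "\<xi> \<equiv> \<xi>\<^sub>0 + a * u" and "\<tau> \<equiv> \<tau>\<^sub>0 + m * (a * u) + d * v"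
    and "Q \<equiv> (2 + M\<^sup>2) powr \<bar>b\<bar> * exp ((3 * \<bar>s\<bar> + 6 * \<bar>b\<bar>) * (\<bar>u\<bar> + \<bar>v\<bar>))"
  shows "weight \<alpha> \<beta> s b \<xi> \<tau> \<le> Q * weight \<alpha> \<beta> s b \<xi>\<^sub>0 \<tau>\<^sub>0"
    and "weight \<alpha> \<beta> s b \<xi>\<^sub>0 \<tau>\<^sub>0 \<le> Q * weight \<alpha> \<beta> s b \<xi> \<tau>"
proof -
  define r where "r = \<bar>u\<bar> + \<bar>v\<bar>"
  \<comment> \<open>exp (3 r) dominates (1 + r)^3, and with it the cubic polynomial in r that the
    expansion of \<open>phi\<close> produces.\<close>
  define E where "E = exp (3 * r)"
  define W where "W = japan (\<tau>\<^sub>0 - phi \<alpha> \<beta> \<xi>\<^sub>0)"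
  have a: "0 < a" "a \<le> 1" and d: "0 < d" "d \<le> M" using ad by (auto simp: adapted_def)
  have M: "0 \<le> M" using d by simp
  have r: "0 \<le> r" "\<bar>u\<bar> \<le> r" "\<bar>v\<bar> \<le> r" by (auto simp: r_def)
  have E1: "1 \<le> E" using r by (simp add: E_def)
  have rE: "1 + r \<le> E" unfolding E_def using r by (intro order_trans[OF _ exp_ge_add_one_self]) simp
  have "(1 + r) ^ 3 \<le> exp r ^ 3" using r by (intro power_mono exp_ge_add_one_self) auto
  also have "\<dots> = E" by (simp add: E_def exp_of_nat_mult[symmetric])
  finally have r3: "(1 + r) ^ 3 \<le> E" .
  have \<xi>\<xi>: "\<bar>\<xi> - \<xi>\<^sub>0\<bar> \<le> r"
  proof -
    have "a * \<bar>u\<bar> \<le> 1 * r" using a r by (intro mult_mono) auto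
    then show ?thesis using a by (simp add: \<xi>_def abs_mult)
  qed
  have x_scale: "japan x \<le> E * japan y" if "\<bar>x - y\<bar> \<le> r" for x y
  proof -
    have "japan x \<le> japan y + r" using japan_le[of x y] that by linarith
    also have "\<dots> \<le> japan y + r * japan y" using r japan_ge_1[of y] by (simp add: mult_le_cancel_left1)
    also have "\<dots> = (1 + r) * japan y" by (simp add: algebra_simps)
    also have "\<dots> \<le> E * japan y" using rE japan_pos[of y] by (intro mult_right_mono) auto
    finally show ?thesis .
  qed
  have sW: "1 \<le> sqrt W" using japan_ge_1 by (simp add: W_def)
  have MW: "M \<le> M * sqrt W" using M sW by (simp add: mult_le_cancel_left1)
  \<comment> \<open>Exact Taylor expansion of the modulation at the centre. The terms are the
    \<tau>-width, the slope mismatch, the curvature and the cubic remainder; the clauses of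
    \<open>adapted\<close> bound them one by one.\<close>
  have "(\<tau> - phi \<alpha> \<beta> \<xi>) - (\<tau>\<^sub>0 - phi \<alpha> \<beta> \<xi>\<^sub>0)
      = d * v + ((m - (3 * \<alpha> * \<xi>\<^sub>0\<^sup>2 - \<beta>)) * a) * u - 3 * (\<alpha> * \<xi>\<^sub>0 * a\<^sup>2) * u\<^sup>2 - \<alpha> * a ^ 3 * u ^ 3"
    by (simp add: \<tau>_def \<xi>_def phi_def power2_eq_square power3_eq_cube algebra_simps)
  also have "\<bar>\<dots>\<bar> \<le> \<bar>d * v\<bar> + \<bar>((m - (3 * \<alpha> * \<xi>\<^sub>0\<^sup>2 - \<beta>)) * a) * u\<bar> + \<bar>3 * (\<alpha> * \<xi>\<^sub>0 * a\<^sup>2) * u\<^sup>2\<bar> + \<bar>\<alpha> * a ^ 3 * u ^ 3\<bar>"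
    by linarith
  also have "\<dots> \<le> (M * sqrt W) * \<bar>v\<bar> + (M * sqrt W) * \<bar>u\<bar> + 3 * ((M * sqrt W) * r\<^sup>2) + (M * sqrt W) * r ^ 3"
  proof (intro add_mono)
    show "\<bar>d * v\<bar> \<le> (M * sqrt W) * \<bar>v\<bar>" using d mult_right_mono[of d "M * sqrt W" "\<bar>v\<bar>"] MW by (simp add: abs_mult)
    show "\<bar>((m - (3 * \<alpha> * \<xi>\<^sub>0\<^sup>2 - \<beta>)) * a) * u\<bar> \<le> (M * sqrt W) * \<bar>u\<bar>"
      using ad a by (simp add: adapted_def W_def abs_mult mult_right_mono)
    have "\<bar>\<alpha>\<bar> * \<bar>\<xi>\<^sub>0\<bar> * a\<^sup>2 \<le> M * sqrt W" using ad MW unfolding adapted_def by linarith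
    then have "\<bar>\<alpha>\<bar> * \<bar>\<xi>\<^sub>0\<bar> * a\<^sup>2 * \<bar>u\<bar>\<^sup>2 \<le> M * sqrt W * r\<^sup>2"
      by (rule mult_mono[OF _ power_mono]) (use M sW r in auto)
    then show "\<bar>3 * (\<alpha> * \<xi>\<^sub>0 * a\<^sup>2) * u\<^sup>2\<bar> \<le> 3 * ((M * sqrt W) * r\<^sup>2)"
      by (simp add: abs_mult)
    have "\<bar>\<alpha>\<bar> * a ^ 3 \<le> M * 1"
      using ad a by (intro mult_mono power_le_one) (auto simp: adapted_def)
    then have "\<bar>\<alpha>\<bar> * a ^ 3 \<le> M * sqrt W" using MW by linarith
    then have "\<bar>\<alpha>\<bar> * a ^ 3 * \<bar>u\<bar> ^ 3 \<le> M * sqrt W * r ^ 3"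
      by (rule mult_mono[OF _ power_mono]) (use M sW r in auto)
    then show "\<bar>\<alpha> * a ^ 3 * u ^ 3\<bar> \<le> (M * sqrt W) * r ^ 3"
      using a by (simp add: abs_mult power_abs)
  qed
  also have "\<dots> = (M * sqrt W) * (r + 3 * r\<^sup>2 + r ^ 3)" by (simp add: r_def algebra_simps)
  also have "\<dots> \<le> (M * sqrt W) * (1 + r) ^ 3"
    using M sW r by (intro mult_left_mono) (auto simp: power2_eq_square power3_eq_cube algebra_simps)
  also have "\<dots> \<le> (M * sqrt W) * E"
    using M sW r3 by (intro mult_left_mono) auto
  finally have diff: "\<bar>(\<tau> - phi \<alpha> \<beta> \<xi>) - (\<tau>\<^sub>0 - phi \<alpha> \<beta> \<xi>\<^sub>0)\<bar> \<le> M * sqrt (japan (\<tau>\<^sub>0 - phi \<alpha> \<beta> \<xi>\<^sub>0)) * E"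
    by (simp add: W_def)
  note t_scale = japan_sandwich[OF diff M E1]
  have K1: "1 \<le> (2 + M\<^sup>2) * E\<^sup>2"
    using mult_mono[of 1 "2 + M\<^sup>2" 1 "E\<^sup>2"] E1 by simp
  have Q: "E powr \<bar>s\<bar> * ((2 + M\<^sup>2) * E\<^sup>2) powr \<bar>b\<bar> = Q"
  proof -
    have "E\<^sup>2 = exp (6 * r)" by (simp add: E_def power2_eq_square exp_add[symmetric])
    then have "((2 + M\<^sup>2) * E\<^sup>2) powr \<bar>b\<bar> = (2 + M\<^sup>2) powr \<bar>b\<bar> * exp (6 * r * \<bar>b\<bar>)"
      by (simp add: powr_mult exp_powr_real)
    moreover have "E powr \<bar>s\<bar> = exp (3 * r * \<bar>s\<bar>)" by (simp add: E_def exp_powr_real)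
    ultimately show ?thesis
      by (simp add: Q_def r_def[symmetric] exp_add[symmetric] mult.left_commute) (simp add: algebra_simps)
  qed
  have x1: "japan \<xi> \<le> E * japan \<xi>\<^sub>0" "japan \<xi>\<^sub>0 \<le> E * japan \<xi>"
    using \<xi>\<xi> by (auto intro!: x_scale simp: abs_minus_commute)
  have "weight \<alpha> \<beta> s b \<xi> \<tau> \<le> (E powr \<bar>s\<bar> * japan \<xi>\<^sub>0 powr s) * (((2 + M\<^sup>2) * E\<^sup>2) powr \<bar>b\<bar> * japan (\<tau>\<^sub>0 - phi \<alpha> \<beta> \<xi>\<^sub>0) powr b)"
    unfolding weight_def by (intro mult_mono powr_sandwich japan_pos E1 x1 t_scale K1) auto
  then show "weight \<alpha> \<beta> s b \<xi> \<tau> \<le> Q * weight \<alpha> \<beta> s b \<xi>\<^sub>0 \<tau>\<^sub>0"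
    unfolding weight_def Q[symmetric] by (simp add: mult_ac)
  have "weight \<alpha> \<beta> s b \<xi>\<^sub>0 \<tau>\<^sub>0 \<le> (E powr \<bar>s\<bar> * japan \<xi> powr s) * (((2 + M\<^sup>2) * E\<^sup>2) powr \<bar>b\<bar> * japan (\<tau> - phi \<alpha> \<beta> \<xi>) powr b)"
    unfolding weight_def by (intro mult_mono powr_sandwich japan_pos E1 x1 t_scale K1) auto
  then show "weight \<alpha> \<beta> s b \<xi>\<^sub>0 \<tau>\<^sub>0 \<le> Q * weight \<alpha> \<beta> s b \<xi> \<tau>"
    unfolding weight_def Q[symmetric] by (simp add: mult_ac)
qed

lemma borel_measurable_weight [measurable]:
  "(\<lambda>z. weight \<alpha> \<beta> s b (fst z) (snd z)) \<in> borel_measurable borel"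
  unfolding weight_def japan_def phi_def by measurable

text \<open>Half of the Gaussian is spent on the linear exponent, by k |u| \<le> k^2/2 + u^2/2. The
  other half is the modulus of a packet, already known to be integrable.\<close>

lemma nn_integral_gaussian_linear_finite:
  "(\<integral>\<^sup>+z. ennreal (exp (k * (\<bar>fst z\<bar> + \<bar>snd z\<bar>) - ((fst z)\<^sup>2 + (snd z)\<^sup>2))) \<partial>(lborel :: (real \<times> real) measure)) < \<infinity>"
proof -
  have q: "k * \<bar>u\<bar> - u\<^sup>2 \<le> k\<^sup>2 / 2 - u\<^sup>2 / 2" for u :: real
  proof -
    have "0 \<le> (\<bar>u\<bar> - k)\<^sup>2" by simp
    then show ?thesis by (simp add: power2_eq_square algebra_simps)
  qed
  have "exp (k * (\<bar>u\<bar> + \<bar>v\<bar>) - (u\<^sup>2 + v\<^sup>2)) \<le> exp (k\<^sup>2) * cmod (packet 1 1 0 0 0 (u, v))" for u v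
  proof -
    have "k * (\<bar>u\<bar> + \<bar>v\<bar>) - (u\<^sup>2 + v\<^sup>2) \<le> k\<^sup>2 + - (u\<^sup>2 + v\<^sup>2) / 2"
      using q[of u] q[of v] by (simp add: distrib_left add_divide_distrib diff_divide_distrib)
    then have "exp (k * (\<bar>u\<bar> + \<bar>v\<bar>) - (u\<^sup>2 + v\<^sup>2)) \<le> exp (k\<^sup>2) * exp (- (u\<^sup>2 + v\<^sup>2) / 2)"
      unfolding exp_add[symmetric] by simp
    then show ?thesis by (simp add: packet_def)
  qed
  then have "(\<integral>\<^sup>+z. ennreal (exp (k * (\<bar>fst z\<bar> + \<bar>snd z\<bar>) - ((fst z)\<^sup>2 + (snd z)\<^sup>2))) \<partial>(lborel :: (real \<times> real) measure))
     \<le> (\<integral>\<^sup>+z. ennreal (norm (exp (k\<^sup>2) * cmod (packet 1 1 0 0 0 z))) \<partial>lborel)"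
    by (intro nn_integral_mono ennreal_leI) (auto simp: abs_mult)
  also have "\<dots> < \<infinity>"
  proof -
    have "integrable lborel (packet 1 1 0 0 0)" by (intro schwartz_integrable schwartz_packet) auto
    then have "integrable lborel (\<lambda>z. exp (k\<^sup>2) * cmod (packet 1 1 0 0 0 z))" by simp
    then show ?thesis unfolding integrable_iff_bounded by blast
  qed
  finally show ?thesis .
qed

section \<open>Upper and lower bounds for packet norms\<close>

lemma cmod_fourier2_packet:
  assumes "a > 0" "d > 0"
  shows "cmod (fourier2 (packet a d m \<xi>\<^sub>0 \<tau>\<^sub>0) (\<xi>, \<tau>))
    = 2 * pi / (a * d) * exp (- (((\<xi> - \<xi>\<^sub>0) / a)\<^sup>2 + ((\<tau> - \<tau>\<^sub>0 - m * (\<xi> - \<xi>\<^sub>0)) / d)\<^sup>2) / 2)"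
  unfolding fourier2_packet[OF assms] norm_of_real using assms by (intro abs_of_nonneg) simp

lemma cmod_fourier2_packet_scaled:
  assumes "a > 0" "d > 0"
  shows "cmod (fourier2 (packet a d m \<xi>\<^sub>0 \<tau>\<^sub>0) (\<xi>\<^sub>0 + a * u, \<tau>\<^sub>0 + m * (a * u) + d * v))
    = 2 * pi / (a * d) * exp (- (u\<^sup>2 + v\<^sup>2) / 2)"
  using assms by (simp add: cmod_fourier2_packet)

lemma fourier2_packet_measurable:
  assumes "a > 0" "d > 0"
  shows "(\<lambda>z. cmod (fourier2 (packet a d m \<xi>\<^sub>0 \<tau>\<^sub>0) z)) \<in> borel_measurable borel"
proof -
  have "(\<lambda>z. cmod (fourier2 (packet a d m \<xi>\<^sub>0 \<tau>\<^sub>0) z)) = (\<lambda>z.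
    2 * pi / (a * d) * exp (- (((fst z - \<xi>\<^sub>0) / a)\<^sup>2 + ((snd z - \<tau>\<^sub>0 - m * (fst z - \<xi>\<^sub>0)) / d)\<^sup>2) / 2))"
    by (intro ext) (metis cmod_fourier2_packet[OF assms] prod.collapse)
  then show ?thesis by simp
qed

text \<open>In packet coordinates the weight is replaced by its central value at the cost of an
  exponential, and the remaining integral \<open>J\<close> is the same for all packets. The Jacobian
  a d against the squared amplitude (2 pi / (a d))^2 leaves 1/(a d).\<close>

lemma packet_nn_integral_le:
  fixes M s b \<alpha> \<beta> :: real
  shows "\<exists>K>0. \<forall>a d m \<xi>\<^sub>0 \<tau>\<^sub>0. adapted M \<alpha> \<beta> a d m \<xi>\<^sub>0 \<tau>\<^sub>0 \<longrightarrow>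
     (\<integral>\<^sup>+z. ennreal ((weight \<alpha> \<beta> s b (fst z) (snd z) * cmod (fourier2 (packet a d m \<xi>\<^sub>0 \<tau>\<^sub>0) z))\<^sup>2) \<partial>lborel)
       \<le> ennreal (K * (weight \<alpha> \<beta> s b \<xi>\<^sub>0 \<tau>\<^sub>0)\<^sup>2 / (a * d))"
proof -
  define k where "k = 3 * \<bar>s\<bar> + 6 * \<bar>b\<bar>"
  define B where "B = (2 + M\<^sup>2) powr \<bar>b\<bar>"
  define g where "g = (\<lambda>z::real\<times>real. exp ((2 * k) * (\<bar>fst z\<bar> + \<bar>snd z\<bar>) - ((fst z)\<^sup>2 + (snd z)\<^sup>2)))"
  define J where "J = enn2real (\<integral>\<^sup>+z. ennreal (g z) \<partial>lborel)"
  have J: "(\<integral>\<^sup>+z. ennreal (g z) \<partial>lborel) = ennreal J"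
    using nn_integral_gaussian_linear_finite[of "2 * k"] unfolding J_def g_def
    by (simp add: less_top)
  have J0: "0 \<le> J" by (simp add: J_def)
  have [measurable]: "g \<in> borel_measurable borel" unfolding g_def by measurable
  define K where "K = B\<^sup>2 * (4 * pi\<^sup>2) * J"
  have "0 \<le> K" using J0 by (simp add: K_def)
  have "(\<integral>\<^sup>+z. ennreal ((weight \<alpha> \<beta> s b (fst z) (snd z) * cmod (fourier2 (packet a d m \<xi>\<^sub>0 \<tau>\<^sub>0) z))\<^sup>2) \<partial>lborel)
       \<le> ennreal (K * (weight \<alpha> \<beta> s b \<xi>\<^sub>0 \<tau>\<^sub>0)\<^sup>2 / (a * d))" (is "?I \<le> _")
    if ad: "adapted M \<alpha> \<beta> a d m \<xi>\<^sub>0 \<tau>\<^sub>0" for a d m \<xi>\<^sub>0 \<tau>\<^sub>0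
  proof -
    have pos: "0 < a" "0 < d" using ad by (auto simp: adapted_def)
    note [measurable] = fourier2_packet_measurable[OF pos]
    let ?w = "weight \<alpha> \<beta> s b \<xi>\<^sub>0 \<tau>\<^sub>0"
    let ?c = "B\<^sup>2 * ?w\<^sup>2 * (2 * pi / (a * d))\<^sup>2"
    have "?I = ennreal (a * d) * (\<integral>\<^sup>+z. ennreal ((weight \<alpha> \<beta> s b (\<xi>\<^sub>0 + a * fst z) (\<tau>\<^sub>0 + m * (a * fst z) + d * snd z)
       * cmod (fourier2 (packet a d m \<xi>\<^sub>0 \<tau>\<^sub>0) (\<xi>\<^sub>0 + a * fst z, \<tau>\<^sub>0 + m * (a * fst z) + d * snd z)))\<^sup>2) \<partial>lborel)"
      by (subst nn_integral_shear[OF _ pos, of _ \<xi>\<^sub>0 \<tau>\<^sub>0 m]) auto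
    also have "\<dots> \<le> ennreal (a * d) * (\<integral>\<^sup>+z. ennreal ?c * ennreal (g z) \<partial>lborel)"
    proof (intro mult_left_mono nn_integral_mono)
      fix z :: "real \<times> real"
      obtain u v where z: "z = (u, v)" by (cases z)
      have "(weight \<alpha> \<beta> s b (\<xi>\<^sub>0 + a * u) (\<tau>\<^sub>0 + m * (a * u) + d * v) * (2 * pi / (a * d) * exp (- (u\<^sup>2 + v\<^sup>2) / 2)))\<^sup>2
          \<le> (B * exp (k * (\<bar>u\<bar> + \<bar>v\<bar>)) * ?w * (2 * pi / (a * d) * exp (- (u\<^sup>2 + v\<^sup>2) / 2)))\<^sup>2"
        using weight_sandwich(1)[OF ad, of s b u v] pos weight_pos[of \<alpha> \<beta> s b]
        by (intro power_mono mult_right_mono) (auto simp: B_def k_def less_imp_le)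
      also have "\<dots> = ?c * ((exp (k * (\<bar>u\<bar> + \<bar>v\<bar>)))\<^sup>2 * (exp (- (u\<^sup>2 + v\<^sup>2) / 2))\<^sup>2)"
        by (simp only: power_mult_distrib mult_ac)
      also have "(exp (k * (\<bar>u\<bar> + \<bar>v\<bar>)))\<^sup>2 * (exp (- (u\<^sup>2 + v\<^sup>2) / 2))\<^sup>2 = g z"
        by (simp add: g_def z exp_add[symmetric] power2_eq_square[of "exp _"] algebra_simps)
      finally show "ennreal ((weight \<alpha> \<beta> s b (\<xi>\<^sub>0 + a * fst z) (\<tau>\<^sub>0 + m * (a * fst z) + d * snd z)
       * cmod (fourier2 (packet a d m \<xi>\<^sub>0 \<tau>\<^sub>0) (\<xi>\<^sub>0 + a * fst z, \<tau>\<^sub>0 + m * (a * fst z) + d * snd z)))\<^sup>2) \<le> ennreal ?c * ennreal (g z)"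
        unfolding cmod_fourier2_packet_scaled[OF pos] by (simp add: z ennreal_mult'[symmetric] ennreal_leI)
    qed simp
    also have "\<dots> = ennreal (a * d * (?c * J))"
      using pos J0 by (subst nn_integral_cmult) (auto simp: J ennreal_mult[symmetric])
    also have "a * d * (?c * J) = K * ?w\<^sup>2 / (a * d)"
      using pos by (simp add: K_def power2_eq_square field_simps)
    finally show ?thesis .
  qed
  \<comment> \<open>Only \<open>J\<close> \<ge> 0 has been shown, so K + 1 supplies a positive
    constant.\<close>
  moreover have "K * w\<^sup>2 / (a * d) \<le> (K + 1) * w\<^sup>2 / (a * d)" if "0 < a" "0 < d" for w a d :: real
    using that by (intro divide_right_mono mult_right_mono) auto
  ultimately have "(\<integral>\<^sup>+z. ennreal ((weight \<alpha> \<beta> s b (fst z) (snd z) * cmod (fourier2 (packet a d m \<xi>\<^sub>0 \<tau>\<^sub>0) z))\<^sup>2) \<partial>lborel)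
       \<le> ennreal ((K + 1) * (weight \<alpha> \<beta> s b \<xi>\<^sub>0 \<tau>\<^sub>0)\<^sup>2 / (a * d))"
    if "adapted M \<alpha> \<beta> a d m \<xi>\<^sub>0 \<tau>\<^sub>0" for a d m \<xi>\<^sub>0 \<tau>\<^sub>0
    using that order_trans ennreal_leI unfolding adapted_def by meson
  then show ?thesis using \<open>0 \<le> K\<close> by (intro exI[of _ "K + 1"]) auto
qed

text \<open>The unit square in packet coordinates already carries enough mass. On it the Gaussian is
  at least exp (-1), and \<xi> moves by at most a \<le> 1/2 \<le> |\<xi>0|/2, so the factor |\<xi>|
  from the derivative stays above |\<xi>0|/2.\<close>

lemma packet_nn_integral_ge:
  fixes M s b \<alpha> \<beta> :: real
  shows "\<exists>K>0. \<forall>a d m \<xi>\<^sub>0 \<tau>\<^sub>0. adapted M \<alpha> \<beta> a d m \<xi>\<^sub>0 \<tau>\<^sub>0 \<longrightarrow> 1 \<le> \<bar>\<xi>\<^sub>0\<bar> \<longrightarrow> a \<le> 1 / 2 \<longrightarrow>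
     ennreal (K * \<xi>\<^sub>0\<^sup>2 * (weight \<alpha> \<beta> s b \<xi>\<^sub>0 \<tau>\<^sub>0)\<^sup>2 / (a * d))
       \<le> (\<integral>\<^sup>+z. ennreal ((weight \<alpha> \<beta> s b (fst z) (snd z) * (\<bar>fst z\<bar> * cmod (fourier2 (packet a d m \<xi>\<^sub>0 \<tau>\<^sub>0) z)))\<^sup>2) \<partial>lborel)"
proof -
  define k where "k = 3 * \<bar>s\<bar> + 6 * \<bar>b\<bar>"
  \<comment> \<open>The factor exp (2 k) is the worst loss in \<open>weight_sandwich\<close> on the
    square, where |u| + |v| \<le> 2.\<close>
  define B where "B = (2 + M\<^sup>2) powr \<bar>b\<bar> * exp (2 * k)"
  define K where "K = pi\<^sup>2 * (exp (- 1))\<^sup>2 / B\<^sup>2"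
  have "2 + M\<^sup>2 \<noteq> 0" using zero_le_power2[of M] by linarith
  then have B: "0 < B" by (simp add: B_def)
  have K: "0 < K" using B by (simp add: K_def)
  have "ennreal (K * \<xi>\<^sub>0\<^sup>2 * (weight \<alpha> \<beta> s b \<xi>\<^sub>0 \<tau>\<^sub>0)\<^sup>2 / (a * d))
       \<le> (\<integral>\<^sup>+z. ennreal ((weight \<alpha> \<beta> s b (fst z) (snd z) * (\<bar>fst z\<bar> * cmod (fourier2 (packet a d m \<xi>\<^sub>0 \<tau>\<^sub>0) z)))\<^sup>2) \<partial>lborel)"
      (is "_ \<le> ?I")
    if ad: "adapted M \<alpha> \<beta> a d m \<xi>\<^sub>0 \<tau>\<^sub>0" and x: "1 \<le> \<bar>\<xi>\<^sub>0\<bar>" and a: "a \<le> 1 / 2" for a d m \<xi>\<^sub>0 \<tau>\<^sub>0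
  proof -
    have pos: "0 < a" "0 < d" using ad by (auto simp: adapted_def)
    note [measurable] = fourier2_packet_measurable[OF pos]
    let ?w = "weight \<alpha> \<beta> s b \<xi>\<^sub>0 \<tau>\<^sub>0"
    let ?S = "{0..1} \<times> {0..1} :: (real \<times> real) set"
    let ?c = "(?w / B * (\<bar>\<xi>\<^sub>0\<bar> / 2 * (2 * pi / (a * d) * exp (- 1))))\<^sup>2"
    have S: "emeasure lborel ?S = 1"
      by (subst lborel_prod[symmetric], subst lborel.emeasure_pair_measure_Times) auto
    have "K * \<xi>\<^sub>0\<^sup>2 * ?w\<^sup>2 / (a * d) = a * d * ?c"
      using pos B by (simp add: K_def power_mult_distrib power_divide) (simp add: power2_eq_square field_simps)
    then have "ennreal (K * \<xi>\<^sub>0\<^sup>2 * ?w\<^sup>2 / (a * d)) = ennreal (a * d) * (\<integral>\<^sup>+z. ennreal ?c * indicator ?S z \<partial>lborel)"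
      using pos by (subst nn_integral_cmult_indicator) (auto simp: S ennreal_mult[symmetric] intro: borel_Times)
    also have "\<dots> \<le> ennreal (a * d) * (\<integral>\<^sup>+z. ennreal ((weight \<alpha> \<beta> s b (\<xi>\<^sub>0 + a * fst z) (\<tau>\<^sub>0 + m * (a * fst z) + d * snd z)
       * (\<bar>\<xi>\<^sub>0 + a * fst z\<bar> * cmod (fourier2 (packet a d m \<xi>\<^sub>0 \<tau>\<^sub>0) (\<xi>\<^sub>0 + a * fst z, \<tau>\<^sub>0 + m * (a * fst z) + d * snd z))))\<^sup>2) \<partial>lborel)"
    proof (intro mult_left_mono nn_integral_mono)
      fix z :: "real \<times> real"
      obtain u v where z: "z = (u, v)" by (cases z)
      let ?r = "(weight \<alpha> \<beta> s b (\<xi>\<^sub>0 + a * u) (\<tau>\<^sub>0 + m * (a * u) + d * v) *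
          (\<bar>\<xi>\<^sub>0 + a * u\<bar> * (2 * pi / (a * d) * exp (- (u\<^sup>2 + v\<^sup>2) / 2))))\<^sup>2"
      have "?c \<le> ?r" if "u \<in> {0..1}" "v \<in> {0..1}"
      proof (intro power_mono mult_mono)
        have "k * (\<bar>u\<bar> + \<bar>v\<bar>) \<le> k * 2" using that by (intro mult_left_mono) (auto simp: k_def)
        then have "(2 + M\<^sup>2) powr \<bar>b\<bar> * exp (k * (\<bar>u\<bar> + \<bar>v\<bar>)) \<le> B"
          unfolding B_def by (intro mult_left_mono) (auto simp: mult.commute)
        then have "(2 + M\<^sup>2) powr \<bar>b\<bar> * exp (k * (\<bar>u\<bar> + \<bar>v\<bar>)) * weight \<alpha> \<beta> s b (\<xi>\<^sub>0 + a * u) (\<tau>\<^sub>0 + m * (a * u) + d * v)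
           \<le> B * weight \<alpha> \<beta> s b (\<xi>\<^sub>0 + a * u) (\<tau>\<^sub>0 + m * (a * u) + d * v)"
          by (rule mult_right_mono) (rule less_imp_le[OF weight_pos])
        with weight_sandwich(2)[OF ad, of s b u v]
        have "?w \<le> B * weight \<alpha> \<beta> s b (\<xi>\<^sub>0 + a * u) (\<tau>\<^sub>0 + m * (a * u) + d * v)"
          unfolding k_def by linarith
        then show "?w / B \<le> weight \<alpha> \<beta> s b (\<xi>\<^sub>0 + a * u) (\<tau>\<^sub>0 + m * (a * u) + d * v)"
          using B by (simp add: field_simps)
        have "\<bar>a * u\<bar> \<le> 1 / 2 * 1" unfolding abs_mult using that a pos by (intro mult_mono) auto
        then show "\<bar>\<xi>\<^sub>0\<bar> / 2 \<le> \<bar>\<xi>\<^sub>0 + a * u\<bar>" using x by linarith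
        have "u\<^sup>2 \<le> 1" "v\<^sup>2 \<le> 1" using that by (auto intro: power_le_one)
        then show "exp (- 1) \<le> exp (- (u\<^sup>2 + v\<^sup>2) / 2)" by simp
      qed (use pos B weight_pos[THEN less_imp_le] in auto)
      then have "ennreal ?c * indicator ?S z \<le> ennreal ?r"
        by (auto simp: z indicator_def intro: ennreal_leI)
      then show "ennreal ?c * indicator ?S z \<le> ennreal ((weight \<alpha> \<beta> s b (\<xi>\<^sub>0 + a * fst z) (\<tau>\<^sub>0 + m * (a * fst z) + d * snd z)
       * (\<bar>\<xi>\<^sub>0 + a * fst z\<bar> * cmod (fourier2 (packet a d m \<xi>\<^sub>0 \<tau>\<^sub>0) (\<xi>\<^sub>0 + a * fst z, \<tau>\<^sub>0 + m * (a * fst z) + d * snd z))))\<^sup>2)"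
        unfolding cmod_fourier2_packet_scaled[OF pos] by (simp add: z)
    qed simp
    also have "\<dots> = ?I"
      by (subst (2) nn_integral_shear[OF _ pos, of _ \<xi>\<^sub>0 \<tau>\<^sub>0 m]) auto
    finally show ?thesis .
  qed
  then show ?thesis using K by blast
qed

text \<open>When the integral diverges both sides are 0, by the default values of the Bochner
  integral and of \<open>enn2real\<close>. A lower bound for \<open>Xnorm\<close> therefore needs a
  separate proof of finiteness.\<close>

lemma Xnorm_square:
  assumes f: "\<And>z. cmod (fourier2 w z) = f z" and [measurable]: "f \<in> borel_measurable borel"
  shows "(Xnorm \<alpha> \<beta> s b w)\<^sup>2 = enn2real (\<integral>\<^sup>+z. ennreal ((weight \<alpha> \<beta> s b (fst z) (snd z) * f z)\<^sup>2) \<partial>lborel)"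
proof -
  have "(Xnorm \<alpha> \<beta> s b w)\<^sup>2 = (LINT z|lborel. (weight \<alpha> \<beta> s b (fst z) (snd z) * f z)\<^sup>2)"
    unfolding Xnorm_def by (subst real_sqrt_pow2) (auto simp: f weight_def split_def mult.assoc intro!: Bochner_Integration.integral_nonneg)
  also have "\<dots> = enn2real (\<integral>\<^sup>+z. ennreal ((weight \<alpha> \<beta> s b (fst z) (snd z) * f z)\<^sup>2) \<partial>lborel)"
    by (rule integral_eq_nn_integral) auto
  finally show ?thesis .
qed

lemma Xnorm_nonneg: "0 \<le> Xnorm \<alpha> \<beta> s b w"
  unfolding Xnorm_def by (auto intro!: Bochner_Integration.integral_nonneg)

lemma Xnorm_packet_le:
  fixes M s b \<alpha> \<beta> :: real
  shows "\<exists>K>0. \<forall>a d m \<xi>\<^sub>0 \<tau>\<^sub>0. adapted M \<alpha> \<beta> a d m \<xi>\<^sub>0 \<tau>\<^sub>0 \<longrightarrow>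
     (Xnorm \<alpha> \<beta> s b (packet a d m \<xi>\<^sub>0 \<tau>\<^sub>0))\<^sup>2 \<le> K * (weight \<alpha> \<beta> s b \<xi>\<^sub>0 \<tau>\<^sub>0)\<^sup>2 / (a * d)"
proof -
  obtain K where K: "K > 0" and le: "\<And>a d m \<xi>\<^sub>0 \<tau>\<^sub>0. adapted M \<alpha> \<beta> a d m \<xi>\<^sub>0 \<tau>\<^sub>0 \<Longrightarrow>
     (\<integral>\<^sup>+z. ennreal ((weight \<alpha> \<beta> s b (fst z) (snd z) * cmod (fourier2 (packet a d m \<xi>\<^sub>0 \<tau>\<^sub>0) z))\<^sup>2) \<partial>lborel)
       \<le> ennreal (K * (weight \<alpha> \<beta> s b \<xi>\<^sub>0 \<tau>\<^sub>0)\<^sup>2 / (a * d))"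
    using packet_nn_integral_le[of M \<alpha> \<beta> s b] by blast
  have "(Xnorm \<alpha> \<beta> s b (packet a d m \<xi>\<^sub>0 \<tau>\<^sub>0))\<^sup>2 \<le> K * (weight \<alpha> \<beta> s b \<xi>\<^sub>0 \<tau>\<^sub>0)\<^sup>2 / (a * d)"
    if ad: "adapted M \<alpha> \<beta> a d m \<xi>\<^sub>0 \<tau>\<^sub>0" for a d m \<xi>\<^sub>0 \<tau>\<^sub>0
  proof -
    have pos: "0 < a" "0 < d" using ad by (auto simp: adapted_def)
    show ?thesis
      unfolding Xnorm_square[OF refl fourier2_packet_measurable[OF pos]]
      by (rule enn2real_leI[OF _ le[OF ad]]) (use K pos in auto)
  qed
  then show ?thesis using K by blast
qed

lemma Xnorm_partial_x_packet_ge: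
  fixes M s b \<alpha> \<beta> :: real
  shows "\<exists>K>0. \<forall>a d m \<xi>\<^sub>0 \<tau>\<^sub>0. adapted M \<alpha> \<beta> a d m \<xi>\<^sub>0 \<tau>\<^sub>0 \<longrightarrow> 1 \<le> \<bar>\<xi>\<^sub>0\<bar> \<longrightarrow> a \<le> 1 / 2 \<longrightarrow>
     K * \<xi>\<^sub>0\<^sup>2 * (weight \<alpha> \<beta> s b \<xi>\<^sub>0 \<tau>\<^sub>0)\<^sup>2 / (a * d) \<le> (Xnorm \<alpha> \<beta> s b (partial_x (packet a d m \<xi>\<^sub>0 \<tau>\<^sub>0)))\<^sup>2"
proof -
  obtain K where K: "K > 0" and ge: "\<And>a d m \<xi>\<^sub>0 \<tau>\<^sub>0. adapted M \<alpha> \<beta> a d m \<xi>\<^sub>0 \<tau>\<^sub>0 \<Longrightarrow> 1 \<le> \<bar>\<xi>\<^sub>0\<bar> \<Longrightarrow> a \<le> 1 / 2 \<Longrightarrow>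
     ennreal (K * \<xi>\<^sub>0\<^sup>2 * (weight \<alpha> \<beta> s b \<xi>\<^sub>0 \<tau>\<^sub>0)\<^sup>2 / (a * d))
       \<le> (\<integral>\<^sup>+z. ennreal ((weight \<alpha> \<beta> s b (fst z) (snd z) * (\<bar>fst z\<bar> * cmod (fourier2 (packet a d m \<xi>\<^sub>0 \<tau>\<^sub>0) z)))\<^sup>2) \<partial>lborel)"
    using packet_nn_integral_ge[of M \<alpha> \<beta> s b] by blast
  \<comment> \<open>This bound is for finiteness only: |\<xi>| \<le> \<open>japan \<xi>\<close>
    absorbs the derivative into a weight with exponent s + 1.\<close>
  obtain K' where le: "\<And>a d m \<xi>\<^sub>0 \<tau>\<^sub>0. adapted M \<alpha> \<beta> a d m \<xi>\<^sub>0 \<tau>\<^sub>0 \<Longrightarrow>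
     (\<integral>\<^sup>+z. ennreal ((weight \<alpha> \<beta> (s + 1) b (fst z) (snd z) * cmod (fourier2 (packet a d m \<xi>\<^sub>0 \<tau>\<^sub>0) z))\<^sup>2) \<partial>lborel)
       \<le> ennreal (K' * (weight \<alpha> \<beta> (s + 1) b \<xi>\<^sub>0 \<tau>\<^sub>0)\<^sup>2 / (a * d))"
    using packet_nn_integral_le[of M \<alpha> \<beta> "s + 1" b] by blast
  have "K * \<xi>\<^sub>0\<^sup>2 * (weight \<alpha> \<beta> s b \<xi>\<^sub>0 \<tau>\<^sub>0)\<^sup>2 / (a * d) \<le> (Xnorm \<alpha> \<beta> s b (partial_x (packet a d m \<xi>\<^sub>0 \<tau>\<^sub>0)))\<^sup>2"
    if ad: "adapted M \<alpha> \<beta> a d m \<xi>\<^sub>0 \<tau>\<^sub>0" and x: "1 \<le> \<bar>\<xi>\<^sub>0\<bar>" "a \<le> 1 / 2" for a d m \<xi>\<^sub>0 \<tau>\<^sub>0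
  proof -
    have pos: "0 < a" "0 < d" using ad by (auto simp: adapted_def)
    note [measurable] = fourier2_packet_measurable[OF pos]
    let ?I = "\<integral>\<^sup>+z. ennreal ((weight \<alpha> \<beta> s b (fst z) (snd z) * (\<bar>fst z\<bar> * cmod (fourier2 (packet a d m \<xi>\<^sub>0 \<tau>\<^sub>0) z)))\<^sup>2) \<partial>lborel"
    have "weight \<alpha> \<beta> s b \<xi> \<tau> * \<bar>\<xi>\<bar> \<le> weight \<alpha> \<beta> (s + 1) b \<xi> \<tau>" for \<xi> \<tau>
    proof -
      have "weight \<alpha> \<beta> s b \<xi> \<tau> * \<bar>\<xi>\<bar> \<le> weight \<alpha> \<beta> s b \<xi> \<tau> * japan \<xi>"
        using weight_pos[of \<alpha> \<beta> s b \<xi> \<tau>] by (intro mult_left_mono) (auto simp: japan_def)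
      also have "\<dots> = weight \<alpha> \<beta> (s + 1) b \<xi> \<tau>"
        using japan_pos[of \<xi>] by (simp add: weight_def powr_add)
      finally show ?thesis .
    qed
    then have "?I \<le> (\<integral>\<^sup>+z. ennreal ((weight \<alpha> \<beta> (s + 1) b (fst z) (snd z) * cmod (fourier2 (packet a d m \<xi>\<^sub>0 \<tau>\<^sub>0) z))\<^sup>2) \<partial>lborel)"
      unfolding mult.assoc[symmetric]
      by (intro nn_integral_mono ennreal_leI power_mono mult_right_mono) (auto simp: weight_pos less_imp_le)
    also have "\<dots> < \<infinity>" by (rule le_less_trans[OF le[OF ad]]) simp
    finally have fin: "?I < \<infinity>" .
    have "cmod (fourier2 (partial_x (packet a d m \<xi>\<^sub>0 \<tau>\<^sub>0)) z) = \<bar>fst z\<bar> * cmod (fourier2 (packet a d m \<xi>\<^sub>0 \<tau>\<^sub>0) z)" for z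
      using fourier2_partial_x[OF schwartz_packet[OF pos], of m \<xi>\<^sub>0 \<tau>\<^sub>0 "fst z" "snd z"] by (simp add: norm_mult)
    then have "(Xnorm \<alpha> \<beta> s b (partial_x (packet a d m \<xi>\<^sub>0 \<tau>\<^sub>0)))\<^sup>2 = enn2real ?I"
      by (rule Xnorm_square) measurable
    moreover have "enn2real (ennreal (K * \<xi>\<^sub>0\<^sup>2 * (weight \<alpha> \<beta> s b \<xi>\<^sub>0 \<tau>\<^sub>0)\<^sup>2 / (a * d))) \<le> enn2real ?I"
      by (rule enn2real_mono[OF ge[OF ad x] fin[unfolded infinity_ennreal_def]])
    ultimately show ?thesis using K pos by simp
  qed
  then show ?thesis using K by blast
qed

section \<open>Growth rates and the counterexamples\<close>

definition bilinear_estimate :: "real \<Rightarrow> real \<Rightarrow> real \<Rightarrow> real \<Rightarrow> real \<Rightarrow> real \<Rightarrow> bool" where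
  "bilinear_estimate C \<alpha>\<^sub>1 \<alpha>\<^sub>2 \<beta> s b \<longleftrightarrow> (\<forall>w1 w2. schwartz w1 \<longrightarrow> schwartz w2 \<longrightarrow>
     Xnorm \<alpha>\<^sub>1 \<beta> s (b - 1) (partial_x (\<lambda>p. w1 p * w2 p)) \<le> C * Xnorm \<alpha>\<^sub>1 \<beta> s b w1 * Xnorm \<alpha>\<^sub>2 \<beta> s b w2)"

text \<open>The squared left side is at least of order \<xi>^2 W^2 / (2 a), where 2 a is the product
  of the two output widths; the squared right side is at most of order W1^2 W2^2 / a^2. Multiplying
  by 2 a^2 leaves one power of a on the left.\<close>

lemma bilinear_packet_bound:
  assumes est: "bilinear_estimate C \<alpha>\<^sub>1 \<alpha>\<^sub>2 \<beta> s b"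
  shows "\<exists>K. \<forall>a m \<xi>\<^sub>1 \<tau>\<^sub>1 \<xi>\<^sub>2 \<tau>\<^sub>2. adapted M \<alpha>\<^sub>1 \<beta> a 1 m \<xi>\<^sub>1 \<tau>\<^sub>1 \<longrightarrow> adapted M \<alpha>\<^sub>2 \<beta> a 1 m \<xi>\<^sub>2 \<tau>\<^sub>2 \<longrightarrow>
      adapted M \<alpha>\<^sub>1 \<beta> (sqrt 2 * a) (sqrt 2) m (\<xi>\<^sub>1 + \<xi>\<^sub>2) (\<tau>\<^sub>1 + \<tau>\<^sub>2) \<longrightarrow> 1 \<le> \<bar>\<xi>\<^sub>1 + \<xi>\<^sub>2\<bar> \<longrightarrow> sqrt 2 * a \<le> 1 / 2 \<longrightarrow>
      a * (\<xi>\<^sub>1 + \<xi>\<^sub>2)\<^sup>2 * (weight \<alpha>\<^sub>1 \<beta> s (b - 1) (\<xi>\<^sub>1 + \<xi>\<^sub>2) (\<tau>\<^sub>1 + \<tau>\<^sub>2))\<^sup>2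
        \<le> K * ((weight \<alpha>\<^sub>1 \<beta> s b \<xi>\<^sub>1 \<tau>\<^sub>1)\<^sup>2 * (weight \<alpha>\<^sub>2 \<beta> s b \<xi>\<^sub>2 \<tau>\<^sub>2)\<^sup>2)"
proof -
  obtain K1 where K1: "K1 > 0" "\<And>a d m \<xi> \<tau>. adapted M \<alpha>\<^sub>1 \<beta> a d m \<xi> \<tau> \<Longrightarrow>
     (Xnorm \<alpha>\<^sub>1 \<beta> s b (packet a d m \<xi> \<tau>))\<^sup>2 \<le> K1 * (weight \<alpha>\<^sub>1 \<beta> s b \<xi> \<tau>)\<^sup>2 / (a * d)"
    using Xnorm_packet_le by blast
  obtain K2 where K2: "K2 > 0" "\<And>a d m \<xi> \<tau>. adapted M \<alpha>\<^sub>2 \<beta> a d m \<xi> \<tau> \<Longrightarrow>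
     (Xnorm \<alpha>\<^sub>2 \<beta> s b (packet a d m \<xi> \<tau>))\<^sup>2 \<le> K2 * (weight \<alpha>\<^sub>2 \<beta> s b \<xi> \<tau>)\<^sup>2 / (a * d)"
    using Xnorm_packet_le by blast
  obtain K3 where K3: "K3 > 0" "\<And>a d m \<xi> \<tau>. adapted M \<alpha>\<^sub>1 \<beta> a d m \<xi> \<tau> \<Longrightarrow> 1 \<le> \<bar>\<xi>\<bar> \<Longrightarrow> a \<le> 1 / 2 \<Longrightarrow>
     K3 * \<xi>\<^sup>2 * (weight \<alpha>\<^sub>1 \<beta> s (b - 1) \<xi> \<tau>)\<^sup>2 / (a * d) \<le> (Xnorm \<alpha>\<^sub>1 \<beta> s (b - 1) (partial_x (packet a d m \<xi> \<tau>)))\<^sup>2"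
    using Xnorm_partial_x_packet_ge by blast
  show ?thesis
  proof (intro exI[of _ "2 * C\<^sup>2 * K1 * K2 / K3"] allI impI)
    fix a m \<xi>\<^sub>1 \<tau>\<^sub>1 \<xi>\<^sub>2 \<tau>\<^sub>2
    assume 1: "adapted M \<alpha>\<^sub>1 \<beta> a 1 m \<xi>\<^sub>1 \<tau>\<^sub>1" and 2: "adapted M \<alpha>\<^sub>2 \<beta> a 1 m \<xi>\<^sub>2 \<tau>\<^sub>2"
      and 3: "adapted M \<alpha>\<^sub>1 \<beta> (sqrt 2 * a) (sqrt 2) m (\<xi>\<^sub>1 + \<xi>\<^sub>2) (\<tau>\<^sub>1 + \<tau>\<^sub>2)" "1 \<le> \<bar>\<xi>\<^sub>1 + \<xi>\<^sub>2\<bar>" "sqrt 2 * a \<le> 1 / 2"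
    let ?p1 = "packet a 1 m \<xi>\<^sub>1 \<tau>\<^sub>1" and ?p2 = "packet a 1 m \<xi>\<^sub>2 \<tau>\<^sub>2"
    let ?w1 = "(weight \<alpha>\<^sub>1 \<beta> s b \<xi>\<^sub>1 \<tau>\<^sub>1)\<^sup>2" and ?w2 = "(weight \<alpha>\<^sub>2 \<beta> s b \<xi>\<^sub>2 \<tau>\<^sub>2)\<^sup>2"
    let ?w = "(weight \<alpha>\<^sub>1 \<beta> s (b - 1) (\<xi>\<^sub>1 + \<xi>\<^sub>2) (\<tau>\<^sub>1 + \<tau>\<^sub>2))\<^sup>2"
    have a: "0 < a" using 1 by (simp add: adapted_def)
    have "K3 * (\<xi>\<^sub>1 + \<xi>\<^sub>2)\<^sup>2 * ?w / (2 * a)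
        \<le> (Xnorm \<alpha>\<^sub>1 \<beta> s (b - 1) (partial_x (packet (sqrt 2 * a) (sqrt 2) m (\<xi>\<^sub>1 + \<xi>\<^sub>2) (\<tau>\<^sub>1 + \<tau>\<^sub>2))))\<^sup>2"
      using K3(2)[OF 3] by (simp add: mult_ac)
    also have "packet (sqrt 2 * a) (sqrt 2) m (\<xi>\<^sub>1 + \<xi>\<^sub>2) (\<tau>\<^sub>1 + \<tau>\<^sub>2) = (\<lambda>p. ?p1 p * ?p2 p)"
      by (simp add: packet_mult fun_eq_iff)
    also have "(Xnorm \<alpha>\<^sub>1 \<beta> s (b - 1) (partial_x (\<lambda>p. ?p1 p * ?p2 p)))\<^sup>2 \<le> (C * Xnorm \<alpha>\<^sub>1 \<beta> s b ?p1 * Xnorm \<alpha>\<^sub>2 \<beta> s b ?p2)\<^sup>2"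
      using est schwartz_packet[OF a zero_less_one] unfolding bilinear_estimate_def
      by (intro power_mono Xnorm_nonneg) blast
    also have "\<dots> = C\<^sup>2 * ((Xnorm \<alpha>\<^sub>1 \<beta> s b ?p1)\<^sup>2 * (Xnorm \<alpha>\<^sub>2 \<beta> s b ?p2)\<^sup>2)"
      by (simp add: power_mult_distrib)
    also have "\<dots> \<le> C\<^sup>2 * ((K1 * ?w1 / (a * 1)) * (K2 * ?w2 / (a * 1)))"
      using K1(1) a by (intro mult_left_mono mult_mono K1(2)[OF 1] K2(2)[OF 2]) auto
    finally have "K3 * (\<xi>\<^sub>1 + \<xi>\<^sub>2)\<^sup>2 * ?w / (2 * a) * (2 * a\<^sup>2 / K3) \<le> C\<^sup>2 * ((K1 * ?w1 / (a * 1)) * (K2 * ?w2 / (a * 1))) * (2 * a\<^sup>2 / K3)"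
      using K3(1) by (intro mult_right_mono) auto
    moreover have "K3 * (\<xi>\<^sub>1 + \<xi>\<^sub>2)\<^sup>2 * ?w / (2 * a) * (2 * a\<^sup>2 / K3) = a * (\<xi>\<^sub>1 + \<xi>\<^sub>2)\<^sup>2 * ?w"
      using K3(1) a by (simp add: power2_eq_square[of a])
    moreover have "C\<^sup>2 * ((K1 * ?w1 / (a * 1)) * (K2 * ?w2 / (a * 1))) * (2 * a\<^sup>2 / K3) = 2 * C\<^sup>2 * K1 * K2 / K3 * (?w1 * ?w2)"
      using K3(1) a by (simp add: power2_eq_square[of a])
    ultimately show "a * (\<xi>\<^sub>1 + \<xi>\<^sub>2)\<^sup>2 * ?w \<le> 2 * C\<^sup>2 * K1 * K2 / K3 * (?w1 * ?w2)" by simp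
  qed
qed

text \<open>Asymptotic equivalence to c N^k with c > 0, which reduces the comparison of weights to
  adding exponents. Eventual positivity is recorded because real powers of f need it.\<close>

definition growth :: "(real \<Rightarrow> real) \<Rightarrow> real \<Rightarrow> bool" where
  "growth f k \<longleftrightarrow> (\<forall>\<^sub>F N in at_top. 0 < f N) \<and> (\<exists>c>0. ((\<lambda>N. f N / N powr k) \<longlongrightarrow> c) at_top)"

lemma growthI: "((\<lambda>N. f N / N powr k) \<longlongrightarrow> c) at_top \<Longrightarrow> 0 < c \<Longrightarrow> growth f k"
  unfolding growth_def
proof (intro conjI exI[of _ c])
  assume lim: "((\<lambda>N. f N / N powr k) \<longlongrightarrow> c) at_top" and "0 < c"
  from order_tendstoD(1)[OF this] show "\<forall>\<^sub>F N in at_top. 0 < f N"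
    by eventually_elim (simp add: zero_less_divide_iff)
qed

lemma growth_const: "0 < c \<Longrightarrow> growth (\<lambda>_. c) 0"
  by (rule growthI[of _ _ c]) (auto intro!: tendsto_eventually eventually_mono[OF eventually_gt_at_top[of 0]])

lemma growth_mult:
  assumes "growth f k" "growth g l" shows "growth (\<lambda>N. f N * g N) (k + l)"
proof -
  obtain c d where "c > 0" "d > 0" "((\<lambda>N. f N / N powr k) \<longlongrightarrow> c) at_top" "((\<lambda>N. g N / N powr l) \<longlongrightarrow> d) at_top"
    using assms unfolding growth_def by blast
  then show ?thesis
    by (intro growthI[of _ _ "c * d"]) (auto simp: powr_add dest: tendsto_mult)
qed

lemma growth_powr:
  assumes "growth f k" shows "growth (\<lambda>N. f N powr p) (k * p)"
proof -
  obtain c where c: "c > 0" "((\<lambda>N. f N / N powr k) \<longlongrightarrow> c) at_top" and pos: "\<forall>\<^sub>F N in at_top. 0 < f N"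
    using assms unfolding growth_def by blast
  have "((\<lambda>N. (f N / N powr k) powr p) \<longlongrightarrow> c powr p) at_top"
    using c by (intro tendsto_powr) auto
  moreover have "\<forall>\<^sub>F N in at_top. (f N / N powr k) powr p = f N powr p / N powr (k * p)"
    using pos eventually_gt_at_top[of 0] by eventually_elim (simp add: powr_divide powr_powr)
  ultimately have "((\<lambda>N. f N powr p / N powr (k * p)) \<longlongrightarrow> c powr p) at_top"
    by (rule Lim_transform_eventually)
  then show ?thesis by (rule growthI) (use c in simp)
qed

lemma growth_power2:
  assumes "growth f k" shows "growth (\<lambda>N. (f N)\<^sup>2) (2 * k)"
  using growth_mult[OF assms assms] by (simp add: power2_eq_square)

lemma growth_inverse:
  assumes "growth f k" shows "growth (\<lambda>N. inverse (f N)) (- k)"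
proof -
  obtain c where c: "c > 0" "((\<lambda>N. f N / N powr k) \<longlongrightarrow> c) at_top"
    using assms unfolding growth_def by blast
  have "((\<lambda>N. inverse (f N / N powr k)) \<longlongrightarrow> inverse c) at_top"
    using c by (intro tendsto_inverse) auto
  then show ?thesis using c(1)
    by (intro growthI[of _ _ "inverse c"]) (auto simp: powr_minus divide_simps)
qed

lemma growth_at_top:
  assumes "growth f k" "0 < k" shows "filterlim f at_top at_top"
proof -
  obtain c where c: "c > 0" "((\<lambda>N. f N / N powr k) \<longlongrightarrow> c) at_top"
    using assms unfolding growth_def by blast
  have "filterlim (\<lambda>N::real. N powr k) at_top at_top" using assms(2) by real_asymp
  from filterlim_tendsto_pos_mult_at_top[OF c(2,1) this]
  have "filterlim (\<lambda>N. f N / N powr k * N powr k) at_top at_top" .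
  moreover have "\<forall>\<^sub>F N in at_top. f N / N powr k * N powr k = f N"
    using eventually_gt_at_top[of 0] by eventually_elim simp
  ultimately show ?thesis by (rule filterlim_mono_eventually[OF _ order_refl order_refl])
qed

text \<open>Divided by N^n with n > 0, the 1 in \<open>japan\<close> disappears, and c \<noteq> 0
  makes the limit |c| positive.\<close>

lemma growth_japan:
  assumes lim: "((\<lambda>N. g N / N ^ n) \<longlongrightarrow> c) at_top" and c: "c \<noteq> 0" and n: "0 < n"
  shows "growth (\<lambda>N. japan (g N)) (real n)"
proof -
  have "((\<lambda>N::real. inverse (N ^ n)) \<longlongrightarrow> 0) at_top"
    using n by (intro tendsto_inverse_0_at_top filterlim_pow_at_top filterlim_ident) auto
  from tendsto_add[OF this tendsto_rabs[OF lim]]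
  have "((\<lambda>N. inverse (N ^ n) + \<bar>g N / N ^ n\<bar>) \<longlongrightarrow> \<bar>c\<bar>) at_top" by simp
  moreover have "\<forall>\<^sub>F N in at_top. inverse (N ^ n) + \<bar>g N / N ^ n\<bar> = japan (g N) / N powr real n"
    using eventually_gt_at_top[of 0]
    by eventually_elim (simp add: japan_def powr_realpow field_simps)
  ultimately have "((\<lambda>N. japan (g N) / N powr real n) \<longlongrightarrow> \<bar>c\<bar>) at_top"
    by (rule Lim_transform_eventually)
  then show ?thesis using c by (intro growthI) auto
qed

lemma growth_japan_monomial:
  assumes "c \<noteq> 0" "0 < n" shows "growth (\<lambda>N. japan (c * N ^ n)) (real n)"
proof -
  have "((\<lambda>N. c * N ^ n / N ^ n) \<longlongrightarrow> c) at_top"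
    by (rule tendsto_eventually, rule eventually_mono[OF eventually_gt_at_top[of 0]]) simp
  from growth_japan[OF this assms] show ?thesis .
qed

lemma growth_japan_linear: "c \<noteq> 0 \<Longrightarrow> growth (\<lambda>N. japan (c * N)) 1"
  using growth_japan_monomial[of c 1] by simp

lemma growth_weight:
  assumes "growth (\<lambda>N. japan (\<xi> N)) k" "growth (\<lambda>N. japan (\<tau> N - phi \<alpha> \<beta> (\<xi> N))) l"
  shows "growth (\<lambda>N. weight \<alpha> \<beta> s b (\<xi> N) (\<tau> N)) (k * s + l * b)"
  unfolding weight_def by (intro growth_mult growth_powr assms)

text \<open>The quotient \<open>?Z\<close> of the two sides of the packet inequality has a positive
  growth exponent by the last hypothesis, so it is unbounded; the estimate would keep it below
  \<open>K\<close>.\<close>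

lemma no_bilinear_estimate:
  fixes a m \<xi>\<^sub>1 \<tau>\<^sub>1 \<xi>\<^sub>2 \<tau>\<^sub>2 :: "real \<Rightarrow> real"
  assumes "\<forall>\<^sub>F N in at_top. adapted M \<alpha>\<^sub>1 \<beta> (a N) 1 (m N) (\<xi>\<^sub>1 N) (\<tau>\<^sub>1 N)"
    and "\<forall>\<^sub>F N in at_top. adapted M \<alpha>\<^sub>2 \<beta> (a N) 1 (m N) (\<xi>\<^sub>2 N) (\<tau>\<^sub>2 N)"
    and "\<forall>\<^sub>F N in at_top. adapted M \<alpha>\<^sub>1 \<beta> (sqrt 2 * a N) (sqrt 2) (m N) (\<xi>\<^sub>1 N + \<xi>\<^sub>2 N) (\<tau>\<^sub>1 N + \<tau>\<^sub>2 N)"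
    and "\<forall>\<^sub>F N in at_top. 1 \<le> \<bar>\<xi>\<^sub>1 N + \<xi>\<^sub>2 N\<bar>" "\<forall>\<^sub>F N in at_top. sqrt 2 * a N \<le> 1 / 2"
    and a: "growth a k\<^sub>a" and \<xi>: "growth (\<lambda>N. \<bar>\<xi>\<^sub>1 N + \<xi>\<^sub>2 N\<bar>) k\<^sub>0"
    and w: "growth (\<lambda>N. weight \<alpha>\<^sub>1 \<beta> s (b - 1) (\<xi>\<^sub>1 N + \<xi>\<^sub>2 N) (\<tau>\<^sub>1 N + \<tau>\<^sub>2 N)) k"
    and w1: "growth (\<lambda>N. weight \<alpha>\<^sub>1 \<beta> s b (\<xi>\<^sub>1 N) (\<tau>\<^sub>1 N)) k\<^sub>1"
    and w2: "growth (\<lambda>N. weight \<alpha>\<^sub>2 \<beta> s b (\<xi>\<^sub>2 N) (\<tau>\<^sub>2 N)) k\<^sub>2"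
    and k: "2 * (k\<^sub>1 + k\<^sub>2) < k\<^sub>a + 2 * (k\<^sub>0 + k)"
  shows "\<not> bilinear_estimate C \<alpha>\<^sub>1 \<alpha>\<^sub>2 \<beta> s b"
proof
  assume "bilinear_estimate C \<alpha>\<^sub>1 \<alpha>\<^sub>2 \<beta> s b"
  from bilinear_packet_bound[OF this, of M] obtain K where
    K: "\<And>a m \<xi>\<^sub>1 \<tau>\<^sub>1 \<xi>\<^sub>2 \<tau>\<^sub>2. adapted M \<alpha>\<^sub>1 \<beta> a 1 m \<xi>\<^sub>1 \<tau>\<^sub>1 \<Longrightarrow> adapted M \<alpha>\<^sub>2 \<beta> a 1 m \<xi>\<^sub>2 \<tau>\<^sub>2 \<Longrightarrow>
      adapted M \<alpha>\<^sub>1 \<beta> (sqrt 2 * a) (sqrt 2) m (\<xi>\<^sub>1 + \<xi>\<^sub>2) (\<tau>\<^sub>1 + \<tau>\<^sub>2) \<Longrightarrow> 1 \<le> \<bar>\<xi>\<^sub>1 + \<xi>\<^sub>2\<bar> \<Longrightarrow> sqrt 2 * a \<le> 1 / 2 \<Longrightarrow>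
      a * (\<xi>\<^sub>1 + \<xi>\<^sub>2)\<^sup>2 * (weight \<alpha>\<^sub>1 \<beta> s (b - 1) (\<xi>\<^sub>1 + \<xi>\<^sub>2) (\<tau>\<^sub>1 + \<tau>\<^sub>2))\<^sup>2
        \<le> K * ((weight \<alpha>\<^sub>1 \<beta> s b \<xi>\<^sub>1 \<tau>\<^sub>1)\<^sup>2 * (weight \<alpha>\<^sub>2 \<beta> s b \<xi>\<^sub>2 \<tau>\<^sub>2)\<^sup>2)" by blast
  let ?Z = "\<lambda>N. a N * \<bar>\<xi>\<^sub>1 N + \<xi>\<^sub>2 N\<bar>\<^sup>2 * (weight \<alpha>\<^sub>1 \<beta> s (b - 1) (\<xi>\<^sub>1 N + \<xi>\<^sub>2 N) (\<tau>\<^sub>1 N + \<tau>\<^sub>2 N))\<^sup>2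
    * inverse ((weight \<alpha>\<^sub>1 \<beta> s b (\<xi>\<^sub>1 N) (\<tau>\<^sub>1 N))\<^sup>2 * (weight \<alpha>\<^sub>2 \<beta> s b (\<xi>\<^sub>2 N) (\<tau>\<^sub>2 N))\<^sup>2)"
  have "growth ?Z (k\<^sub>a + 2 * k\<^sub>0 + 2 * k + - (2 * k\<^sub>1 + 2 * k\<^sub>2))"
    by (intro growth_mult growth_inverse growth_power2 a \<xi> w w1 w2)
  then have "filterlim ?Z at_top at_top"
    by (rule growth_at_top) (use k in simp)
  then have "\<forall>\<^sub>F N in at_top. K < ?Z N" by (simp add: filterlim_at_top_dense)
  moreover have "\<forall>\<^sub>F N in at_top. ?Z N \<le> K"
    using assms(1-5)
  proof eventually_elim
    case (elim N)
    have "0 < (weight \<alpha>\<^sub>1 \<beta> s b (\<xi>\<^sub>1 N) (\<tau>\<^sub>1 N))\<^sup>2 * (weight \<alpha>\<^sub>2 \<beta> s b (\<xi>\<^sub>2 N) (\<tau>\<^sub>2 N))\<^sup>2"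
      using weight_pos by (intro mult_pos_pos zero_less_power)
    then show ?case using K[OF elim] by (simp add: divide_inverse[symmetric] pos_divide_le_eq)
  qed
  ultimately have "\<forall>\<^sub>F N in at_top::real filter. False" by eventually_elim simp
  then show False by simp
qed

text \<open>With m = 0 the slope mismatch is the slope of the cubic itself, at most 12 |\<alpha>|
  N^2 + |\<beta>| here, and the width a \<le> 2/N^2 makes it bounded. The bound on M covers the
  resulting 24 |\<alpha>| + |\<beta>|, the curvature term 4 |\<alpha>| and d \<le> 2.\<close>

lemma adapted_unsheared:
  assumes "1 \<le> N" "0 < a" "a \<le> 1" "a \<le> 2 / N\<^sup>2" "0 < d" "d \<le> 2" "\<bar>\<xi>\<bar> \<le> 2 * N"
    and M: "2 + 28 * \<bar>\<alpha>\<bar> + 2 * \<bar>\<beta>\<bar> \<le> M"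
  shows "adapted M \<alpha> \<beta> a d 0 \<xi> \<tau>"
proof -
  have aN: "a * N\<^sup>2 \<le> 2" using assms by (simp add: field_simps)
  have xN: "\<bar>\<xi>\<bar>\<^sup>2 \<le> (2 * N)\<^sup>2" using assms(7) by (intro power_mono) auto
  have "N * 1 \<le> N * N" using assms(1) by (intro mult_left_mono) auto
  then have "\<bar>\<xi>\<bar> \<le> 2 * N\<^sup>2" using assms(7) unfolding power2_eq_square by linarith
  then have "\<bar>\<xi>\<bar> * a\<^sup>2 \<le> (2 * N\<^sup>2) * (a * 1)"
    unfolding power2_eq_square[of a] using assms by (intro mult_mono) auto
  also have "\<dots> \<le> 4" using aN by simp
  finally have "\<bar>\<alpha>\<bar> * (\<bar>\<xi>\<bar> * a\<^sup>2) \<le> \<bar>\<alpha>\<bar> * 4" by (rule mult_left_mono) simp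
  then have 1: "\<bar>\<alpha>\<bar> * \<bar>\<xi>\<bar> * a\<^sup>2 \<le> M" using M by (simp add: mult.assoc)
  have "\<bar>0 - (3 * \<alpha> * \<xi>\<^sup>2 - \<beta>)\<bar> \<le> 3 * (\<bar>\<alpha>\<bar> * \<bar>\<xi>\<bar>\<^sup>2) + \<bar>\<beta>\<bar>"
    using abs_triangle_ineq4[of \<beta> "3 * \<alpha> * \<xi>\<^sup>2"] by (simp add: abs_mult)
  then have "\<bar>0 - (3 * \<alpha> * \<xi>\<^sup>2 - \<beta>)\<bar> * a \<le> (3 * (\<bar>\<alpha>\<bar> * \<bar>\<xi>\<bar>\<^sup>2) + \<bar>\<beta>\<bar>) * a"
    using assms(2) by (intro mult_right_mono) auto
  also have "\<dots> \<le> (3 * (\<bar>\<alpha>\<bar> * (2 * N)\<^sup>2) + \<bar>\<beta>\<bar>) * a"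
    using assms(2) xN by (intro mult_right_mono add_right_mono mult_left_mono) auto
  also have "\<dots> = 12 * \<bar>\<alpha>\<bar> * (a * N\<^sup>2) + \<bar>\<beta>\<bar> * a" by (simp add: algebra_simps power_mult_distrib)
  also have "\<dots> \<le> 12 * \<bar>\<alpha>\<bar> * 2 + \<bar>\<beta>\<bar> * 1"
    using aN assms by (intro add_mono mult_left_mono) auto
  also have "\<dots> \<le> M * 1" using M by simp
  also have "\<dots> \<le> M * sqrt (japan (\<tau> - phi \<alpha> \<beta> \<xi>))"
    using M japan_ge_1 by (intro mult_left_mono) auto
  finally show ?thesis using 1 assms by (auto simp: adapted_def)
qed

text \<open>The \<open>\<xi>\<close>-width \<open>N\<^sup>-\<^sup>2\<close> keeps the unsheared packets inside a unit neighbourhood of the cubics.\<close>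

lemma no_bilinear_estimate_output_modulation:
  assumes \<xi>\<^sub>2: "\<And>N. 1 \<le> N \<Longrightarrow> \<bar>\<xi>\<^sub>2 N\<bar> \<le> N" "((\<lambda>N. \<xi>\<^sub>2 N / N) \<longlongrightarrow> c) at_top" "c \<noteq> 0"
    and \<xi>: "\<And>N. 1 \<le> N \<Longrightarrow> 1 \<le> \<bar>N + \<xi>\<^sub>2 N\<bar>" "growth (\<lambda>N. \<bar>N + \<xi>\<^sub>2 N\<bar>) k\<^sub>0" "growth (\<lambda>N. japan (N + \<xi>\<^sub>2 N)) k\<^sub>0"
    and H: "((\<lambda>N. (phi \<alpha>\<^sub>1 \<beta> N + phi \<alpha>\<^sub>2 \<beta> (\<xi>\<^sub>2 N) - phi \<alpha>\<^sub>1 \<beta> (N + \<xi>\<^sub>2 N)) / N ^ 3) \<longlongrightarrow> h) at_top" "h \<noteq> 0"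
    and k: "4 * s < - 2 + 2 * k\<^sub>0 + 2 * (k\<^sub>0 * s + 3 * (b - 1))"
  shows "\<not> bilinear_estimate C \<alpha>\<^sub>1 \<alpha>\<^sub>2 \<beta> s b"
proof -
  define M where "M = 2 + 28 * (\<bar>\<alpha>\<^sub>1\<bar> + \<bar>\<alpha>\<^sub>2\<bar>) + 2 * \<bar>\<beta>\<bar>"
  have M: "2 + 28 * \<bar>\<alpha>\<^sub>1\<bar> + 2 * \<bar>\<beta>\<bar> \<le> M" "2 + 28 * \<bar>\<alpha>\<^sub>2\<bar> + 2 * \<bar>\<beta>\<bar> \<le> M" by (auto simp: M_def)
  have s2: "1 \<le> sqrt 2" "sqrt 2 \<le> (2::real)" by (auto intro: real_le_lsqrt)
  have large: "\<forall>\<^sub>F N::real in at_top. 4 \<le> N" by (rule eventually_ge_at_top)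
  have small: "0 < 1 / N\<^sup>2" "1 / N\<^sup>2 \<le> 1" "1 / N\<^sup>2 \<le> 2 / N\<^sup>2" "0 < sqrt 2 * (1 / N\<^sup>2)"
     "sqrt 2 * (1 / N\<^sup>2) \<le> 1" "sqrt 2 * (1 / N\<^sup>2) \<le> 2 / N\<^sup>2" "sqrt 2 * (1 / N\<^sup>2) \<le> 1 / 2" if "4 \<le> N" for N :: real
  proof -
    have N: "4\<^sup>2 \<le> N\<^sup>2" using that by (intro power_mono) auto
    show "0 < 1 / N\<^sup>2" "1 / N\<^sup>2 \<le> 1" "1 / N\<^sup>2 \<le> 2 / N\<^sup>2" "0 < sqrt 2 * (1 / N\<^sup>2)"
      using that N by (simp_all add: divide_right_mono)
    show *: "sqrt 2 * (1 / N\<^sup>2) \<le> 2 / N\<^sup>2" using s2 N by (simp add: divide_right_mono)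
    have "2 / N\<^sup>2 \<le> 2 / 16" using N by (intro divide_left_mono) auto
    with * show "sqrt 2 * (1 / N\<^sup>2) \<le> 1 / 2" "sqrt 2 * (1 / N\<^sup>2) \<le> 1" by linarith+
  qed
  show ?thesis
  proof (rule no_bilinear_estimate[where a="\<lambda>N. 1 / N\<^sup>2" and m="\<lambda>_. 0" and \<xi>\<^sub>1="\<lambda>N. N" and \<xi>\<^sub>2=\<xi>\<^sub>2
        and \<tau>\<^sub>1="\<lambda>N. phi \<alpha>\<^sub>1 \<beta> N" and \<tau>\<^sub>2="\<lambda>N. phi \<alpha>\<^sub>2 \<beta> (\<xi>\<^sub>2 N)" and M=M and k\<^sub>a="-2"])
    show "\<forall>\<^sub>F N in at_top. adapted M \<alpha>\<^sub>1 \<beta> (1 / N\<^sup>2) 1 0 N (phi \<alpha>\<^sub>1 \<beta> N)"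
      using large
    proof eventually_elim
      case (elim N)
      then show ?case using small[OF elim] M by (intro adapted_unsheared[of N]) (auto simp: divide_right_mono)
    qed
    show "\<forall>\<^sub>F N in at_top. adapted M \<alpha>\<^sub>2 \<beta> (1 / N\<^sup>2) 1 0 (\<xi>\<^sub>2 N) (phi \<alpha>\<^sub>2 \<beta> (\<xi>\<^sub>2 N))"
      using large
    proof eventually_elim
      case (elim N)
      then show ?case using small[OF elim] M \<xi>\<^sub>2(1)[of N]
        by (intro adapted_unsheared[of N]) (auto simp: divide_right_mono)
    qed
    show "\<forall>\<^sub>F N in at_top. adapted M \<alpha>\<^sub>1 \<beta> (sqrt 2 * (1 / N\<^sup>2)) (sqrt 2) 0 (N + \<xi>\<^sub>2 N) (phi \<alpha>\<^sub>1 \<beta> N + phi \<alpha>\<^sub>2 \<beta> (\<xi>\<^sub>2 N))"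
      using large
    proof eventually_elim
      case (elim N)
      then show ?case using small[OF elim] M s2 \<xi>\<^sub>2(1)[of N] by (intro adapted_unsheared[of N]) auto
    qed
    show "\<forall>\<^sub>F N in at_top. 1 \<le> \<bar>N + \<xi>\<^sub>2 N\<bar>" using large by eventually_elim (rule \<xi>, simp)
    show "\<forall>\<^sub>F N in at_top. sqrt 2 * (1 / N\<^sup>2) \<le> 1 / 2" using large by eventually_elim (rule small)
    show "growth (\<lambda>N. 1 / N\<^sup>2) (- 2)"
      by (rule growthI[of _ _ 1])
         (auto intro!: tendsto_eventually eventually_mono[OF eventually_gt_at_top[of 0]] simp: powr_minus divide_simps)
    have j: "growth (\<lambda>N. japan N) 1"
      using growth_japan_linear[of 1] by simp
    have j2: "growth (\<lambda>N. japan (\<xi>\<^sub>2 N)) 1"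
      using growth_japan[of \<xi>\<^sub>2 1 c] \<xi>\<^sub>2 by simp
    have zero: "growth (\<lambda>N. japan (x N - x N)) 0" for x :: "real \<Rightarrow> real" by (simp add: japan_def growth_const)
    show "growth (\<lambda>N. weight \<alpha>\<^sub>1 \<beta> s b N (phi \<alpha>\<^sub>1 \<beta> N)) (1 * s + 0 * b)"
      by (intro growth_weight j zero)
    show "growth (\<lambda>N. weight \<alpha>\<^sub>2 \<beta> s b (\<xi>\<^sub>2 N) (phi \<alpha>\<^sub>2 \<beta> (\<xi>\<^sub>2 N))) (1 * s + 0 * b)"
      by (intro growth_weight j2 zero)
    \<comment> \<open>With both inputs on their cubics, the output modulation is the resonance
      function, of order N^3 by \<open>H\<close>.\<close>
    have "growth (\<lambda>N. japan (phi \<alpha>\<^sub>1 \<beta> N + phi \<alpha>\<^sub>2 \<beta> (\<xi>\<^sub>2 N) - phi \<alpha>\<^sub>1 \<beta> (N + \<xi>\<^sub>2 N))) 3"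
      using growth_japan[OF H] by simp
    then show "growth (\<lambda>N. weight \<alpha>\<^sub>1 \<beta> s (b - 1) (N + \<xi>\<^sub>2 N) (phi \<alpha>\<^sub>1 \<beta> N + phi \<alpha>\<^sub>2 \<beta> (\<xi>\<^sub>2 N))) (k\<^sub>0 * s + 3 * (b - 1))"
      by (intro growth_weight \<xi>)
    show "growth (\<lambda>N. \<bar>N + \<xi>\<^sub>2 N\<bar>) k\<^sub>0" by (rule \<xi>)
  qed (use k in simp)
qed

text \<open>The width \<open>N\<^sup>-\<^sup>1\<^sup>/\<^sup>2\<close> is the largest allowed by the curvature \<open>6 \<alpha>\<^sub>1 N\<close> of the cubic, to which \<open>w\<^sub>1\<close>
  and the output are tangent: the derivative of \<open>phi \<alpha>\<^sub>1 \<beta>\<close> is even.\<close>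

lemma no_bilinear_estimate_input_modulation:
  assumes \<alpha>: "\<alpha>\<^sub>1 \<noteq> 4 * \<alpha>\<^sub>2" and b: "s + 3 * b < 3 / 4"
  shows "\<not> bilinear_estimate C \<alpha>\<^sub>1 \<alpha>\<^sub>2 \<beta> s b"
proof -
  \<comment> \<open>h N^3 is the modulus of the central modulation of the second input, by the
    identity \<open>H\<close> below; \<open>\<alpha>\<close> makes it nonzero.\<close>
  define h where "h = \<bar>2 * \<alpha>\<^sub>1 - 8 * \<alpha>\<^sub>2\<bar>"
  have h: "0 < h" using \<alpha> by (simp add: h_def)
  \<comment> \<open>The terms 2 |\<alpha>1| and 2 |\<alpha>2| bound the curvature products of the
    output and the second input. The quotient compares the slope mismatch of the second input over
    its width, |3 \<alpha>1 - 12 \<alpha>2| N^(3/2), with sqrt (h N^3).\<close>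
  define M where "M = 2 + 2 * \<bar>\<alpha>\<^sub>1\<bar> + 2 * \<bar>\<alpha>\<^sub>2\<bar> + \<bar>3 * \<alpha>\<^sub>1 - 12 * \<alpha>\<^sub>2\<bar> / sqrt h"
  have M0: "0 \<le> \<bar>3 * \<alpha>\<^sub>1 - 12 * \<alpha>\<^sub>2\<bar> / sqrt h" using h by simp
  have M: "2 \<le> M" "2 * \<bar>\<alpha>\<^sub>1\<bar> \<le> M" "2 * \<bar>\<alpha>\<^sub>2\<bar> \<le> M" "\<bar>3 * \<alpha>\<^sub>1 - 12 * \<alpha>\<^sub>2\<bar> / sqrt h \<le> M"
    using M0 by (auto simp: M_def)
  have s2: "sqrt 2 \<le> (2::real)" by (auto intro: real_le_lsqrt)
  let ?m = "\<lambda>N::real. 3 * \<alpha>\<^sub>1 * N\<^sup>2 - \<beta>"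
  have large: "\<forall>\<^sub>F N::real in at_top. 16 \<le> N" by (rule eventually_ge_at_top)
  have small: "0 < 1 / sqrt N" "1 / sqrt N \<le> 1" "sqrt 2 * (1 / sqrt N) \<le> 1 / 2" if "16 \<le> N" for N :: real
  proof -
    have N: "4 \<le> sqrt N" using that by (simp add: real_le_rsqrt)
    then show "0 < 1 / sqrt N" "1 / sqrt N \<le> 1" using that by simp_all
    have "sqrt 2 * (1 / sqrt N) \<le> 2 * (1 / 4)"
      using N s2 that by (intro mult_mono divide_left_mono) auto
    then show "sqrt 2 * (1 / sqrt N) \<le> 1 / 2" by simp
  qed
  have H: "2 * phi \<alpha>\<^sub>1 \<beta> N - phi \<alpha>\<^sub>2 \<beta> (2 * N) = (2 * \<alpha>\<^sub>1 - 8 * \<alpha>\<^sub>2) * N ^ 3" for N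
    by (simp add: phi_def algebra_simps power_mult_distrib)
  have odd: "phi \<alpha>\<^sub>1 \<beta> (- N) + 2 * phi \<alpha>\<^sub>1 \<beta> N = phi \<alpha>\<^sub>1 \<beta> N" for N
    by (simp add: phi_def)
  show ?thesis
  \<comment> \<open>The height \<open>\<tau>\<^sub>2\<close> is chosen so that the output centre is
    (N, \<open>phi \<alpha>\<^sub>1 \<beta> N\<close>), on the first cubic, since \<open>phi\<close>
    is odd.\<close>
  proof (rule no_bilinear_estimate[where a="\<lambda>N. 1 / sqrt N" and m="?m" and \<xi>\<^sub>1="\<lambda>N. - N" and \<xi>\<^sub>2="\<lambda>N. 2 * N"
        and \<tau>\<^sub>1="\<lambda>N. phi \<alpha>\<^sub>1 \<beta> (- N)" and \<tau>\<^sub>2="\<lambda>N. 2 * phi \<alpha>\<^sub>1 \<beta> N" and M=M and k\<^sub>a="-1/2" and k\<^sub>0=1])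
    show "\<forall>\<^sub>F N in at_top. adapted M \<alpha>\<^sub>1 \<beta> (1 / sqrt N) 1 (?m N) (- N) (phi \<alpha>\<^sub>1 \<beta> (- N))"
      using large
      by eventually_elim (use small M in \<open>auto simp: adapted_def power_divide japan_def\<close>)
    show "\<forall>\<^sub>F N in at_top. adapted M \<alpha>\<^sub>2 \<beta> (1 / sqrt N) 1 (?m N) (2 * N) (2 * phi \<alpha>\<^sub>1 \<beta> N)"
      using large
    proof eventually_elim
      case (elim N)
      have "?m N - (3 * \<alpha>\<^sub>2 * (2 * N)\<^sup>2 - \<beta>) = (3 * \<alpha>\<^sub>1 - 12 * \<alpha>\<^sub>2) * N\<^sup>2"
        by (simp add: power_mult_distrib algebra_simps)
      then have "\<bar>?m N - (3 * \<alpha>\<^sub>2 * (2 * N)\<^sup>2 - \<beta>)\<bar> * (1 / sqrt N) = \<bar>3 * \<alpha>\<^sub>1 - 12 * \<alpha>\<^sub>2\<bar> / sqrt h * (sqrt h * (N\<^sup>2 / sqrt N))"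
        using h by (simp add: abs_mult)
      also have "N\<^sup>2 / sqrt N = sqrt (N ^ 3)"
      proof -
        have "sqrt (N ^ 3) * sqrt N = sqrt ((N\<^sup>2)\<^sup>2)"
          unfolding real_sqrt_mult[symmetric] by (simp add: power2_eq_square power3_eq_cube mult_ac)
        also have "\<dots> = N\<^sup>2" unfolding real_sqrt_abs by simp
        finally show ?thesis using elim by (simp add: divide_eq_eq)
      qed
      also have "\<bar>3 * \<alpha>\<^sub>1 - 12 * \<alpha>\<^sub>2\<bar> / sqrt h * (sqrt h * sqrt (N ^ 3)) \<le> M * sqrt (japan (2 * phi \<alpha>\<^sub>1 \<beta> N - phi \<alpha>\<^sub>2 \<beta> (2 * N)))"
      proof (rule mult_mono)
        show "sqrt h * sqrt (N ^ 3) \<le> sqrt (japan (2 * phi \<alpha>\<^sub>1 \<beta> N - phi \<alpha>\<^sub>2 \<beta> (2 * N)))"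
          unfolding H real_sqrt_mult[symmetric] using elim by (simp add: japan_def h_def abs_mult)
      qed (use M h elim in auto)
      finally show ?case using small[OF elim] M elim by (auto simp: adapted_def power_divide)
    qed
    show "\<forall>\<^sub>F N in at_top. adapted M \<alpha>\<^sub>1 \<beta> (sqrt 2 * (1 / sqrt N)) (sqrt 2) (?m N) (- N + 2 * N) (phi \<alpha>\<^sub>1 \<beta> (- N) + 2 * phi \<alpha>\<^sub>1 \<beta> N)"
      using large
    proof eventually_elim
      case (elim N)
      then show ?case using small[OF elim] M s2 by (auto simp: adapted_def power_divide power_mult_distrib japan_def)
    qed
    show "\<forall>\<^sub>F N::real in at_top. 1 \<le> \<bar>- N + 2 * N\<bar>" using large by eventually_elim simp
    show "\<forall>\<^sub>F N in at_top. sqrt 2 * (1 / sqrt N) \<le> 1 / 2" using large by eventually_elim (rule small)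
    show "growth (\<lambda>N. 1 / sqrt N) (- 1 / 2)"
      by (rule growthI[of _ _ 1])
         (auto intro!: tendsto_eventually eventually_mono[OF eventually_gt_at_top[of 0]]
               simp: powr_minus powr_half_sqrt divide_simps)
    show "growth (\<lambda>N. \<bar>- N + 2 * N\<bar>) 1"
      by (rule growthI[of _ _ 1]) (auto intro!: tendsto_eventually eventually_mono[OF eventually_gt_at_top[of 0]])
    have zero: "growth (\<lambda>N. japan (x N - x N)) 0" for x :: "real \<Rightarrow> real" by (simp add: japan_def growth_const)
    show "growth (\<lambda>N. weight \<alpha>\<^sub>1 \<beta> s b (- N) (phi \<alpha>\<^sub>1 \<beta> (- N))) (1 * s + 0 * b)"
      using growth_japan_linear[of "-1"] by (intro growth_weight zero) simp
    show "growth (\<lambda>N. weight \<alpha>\<^sub>1 \<beta> s (b - 1) (- N + 2 * N) (phi \<alpha>\<^sub>1 \<beta> (- N) + 2 * phi \<alpha>\<^sub>1 \<beta> N)) (1 * s + 0 * (b - 1))"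
      unfolding odd using growth_japan_linear[of 1] zero by (intro growth_weight) simp_all
    have "growth (\<lambda>N. japan ((2 * \<alpha>\<^sub>1 - 8 * \<alpha>\<^sub>2) * N ^ 3)) 3"
      using growth_japan_monomial[of "2 * \<alpha>\<^sub>1 - 8 * \<alpha>\<^sub>2" 3] \<alpha> by simp
    then show "growth (\<lambda>N. weight \<alpha>\<^sub>2 \<beta> s b (2 * N) (2 * phi \<alpha>\<^sub>1 \<beta> N)) (1 * s + 3 * b)"
      using growth_japan_linear[of 2] by (intro growth_weight) (simp_all add: H)
  \<comment> \<open>The exponents give 2 (2 s + 3 b) < -1/2 + 2 (1 + s), which is the hypothesis on
    s + 3 b.\<close>
  qed (use b in simp)
qed

theorem theorem1p13:
  fixes \<alpha>1 \<alpha>2 \<beta> s b :: real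
  assumes "\<alpha>1 * \<alpha>2 < 0"
    and "s < -13/12
         \<or> (-13/12 \<le> s \<and> s \<le> -1 \<and> \<not> (1/4 - s / 3 \<le> b \<and> b \<le> 4/3 + 2 * s / 3))
         \<or> (-1 < s \<and> s < -3/4 \<and> \<not> (1/4 - s / 3 \<le> b \<and> b \<le> 1 + s / 3))"
  shows "\<not> (\<exists>C. \<forall>w1 w2. schwartz w1 \<longrightarrow> schwartz w2 \<longrightarrow>
            Xnorm \<alpha>1 \<beta> s (b - 1) (partial_x (\<lambda>p. w1 p * w2 p))
              \<le> C * Xnorm \<alpha>1 \<beta> s b w1 * Xnorm \<alpha>2 \<beta> s b w2)"
proof -
  \<comment> \<open>Opposite signs exclude positive ratios. The values k = 4, 1, 7 are the ones at
    which the leading coefficients of the three modulations would vanish.\<close>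
  have ne: "\<alpha>1 - k * \<alpha>2 \<noteq> 0" "\<alpha>2 - k * \<alpha>1 \<noteq> 0" if "0 < k" for k
  proof -
    have "\<alpha>1 \<noteq> k * \<alpha>2"
    proof
      assume "\<alpha>1 = k * \<alpha>2"
      then have "\<alpha>1 * \<alpha>2 = k * \<alpha>2\<^sup>2" by (simp add: power2_eq_square)
      with assms(1) that show False by (simp add: mult_less_0_iff)
    qed
    moreover have "\<alpha>2 \<noteq> k * \<alpha>1"
    proof
      assume "\<alpha>2 = k * \<alpha>1"
      then have "\<alpha>1 * \<alpha>2 = k * \<alpha>1\<^sup>2" by (simp add: power2_eq_square)
      with assms(1) that show False by (simp add: mult_less_0_iff)
    qed
    ultimately show "\<alpha>1 - k * \<alpha>2 \<noteq> 0" "\<alpha>2 - k * \<alpha>1 \<noteq> 0" by auto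
  qed
  \<comment> \<open>These are b < 1/4 - s/3, b > 4/3 + 2 s/3 and b > 1 + s/3. For s < -13/12 the
    first two cover every b, because then 1/4 - s/3 > 4/3 + 2 s/3.\<close>
  consider "s + 3 * b < 3 / 4" | "4 + 2 * s < 3 * b" | "3 + s < 3 * b"
    using assms(2) by argo
  then have "\<not> bilinear_estimate C \<alpha>1 \<alpha>2 \<beta> s b" for C
  proof cases
    case 1
    then show ?thesis using ne(1)[of 4] by (intro no_bilinear_estimate_input_modulation) auto
  next
    case 2
    \<comment> \<open>The \<beta>-terms cancel because the frequencies add; expanding (1 - N)^3 and
      dividing by N^3 leaves \<alpha>1 - \<alpha>2 in the limit.\<close>
    have "((\<lambda>N::real. (\<alpha>1 - 1 * \<alpha>2) + 3 * \<alpha>2 * (1 / N) - 3 * \<alpha>2 * (1 / N\<^sup>2) + (\<alpha>2 - \<alpha>1) * (1 / N ^ 3))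
        \<longlongrightarrow> (\<alpha>1 - 1 * \<alpha>2) + 3 * \<alpha>2 * 0 - 3 * \<alpha>2 * 0 + (\<alpha>2 - \<alpha>1) * 0) at_top"
      by (intro tendsto_intros) real_asymp+
    moreover have "\<forall>\<^sub>F N in at_top. (\<alpha>1 - 1 * \<alpha>2) + 3 * \<alpha>2 * (1 / N) - 3 * \<alpha>2 * (1 / N\<^sup>2) + (\<alpha>2 - \<alpha>1) * (1 / N ^ 3)
        = (phi \<alpha>1 \<beta> N + phi \<alpha>2 \<beta> (1 - N) - phi \<alpha>1 \<beta> (N + (1 - N))) / N ^ 3"
      using eventually_gt_at_top[of 0]
      by eventually_elim (simp add: phi_def field_simps power2_eq_square power3_eq_cube)
    ultimately have H: "((\<lambda>N. (phi \<alpha>1 \<beta> N + phi \<alpha>2 \<beta> (1 - N) - phi \<alpha>1 \<beta> (N + (1 - N))) / N ^ 3) \<longlongrightarrow> \<alpha>1 - 1 * \<alpha>2) at_top"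
      by (auto dest: Lim_transform_eventually)
    show ?thesis
    proof (rule no_bilinear_estimate_output_modulation[OF _ _ _ _ _ _ H ne(1)])
      show "((\<lambda>N::real. (1 - N) / N) \<longlongrightarrow> - 1) at_top" by real_asymp
      show "growth (\<lambda>N. \<bar>N + (1 - N)\<bar>) 0" "growth (\<lambda>N. japan (N + (1 - N))) 0"
        using growth_const[of 1] growth_const[of 2] by (simp_all add: japan_def)
    \<comment> \<open>The output frequency is 1, so \<open>k\<^sub>0\<close> = 0 and the exponent
      condition reads 4 s < -2 + 6 (b - 1).\<close>
    qed (use 2 in auto)
  next
    case 3
    \<comment> \<open>The output frequency 2 N contributes 8 \<alpha>1, so the resonance is exactly
      (\<alpha>1 + \<alpha>2 - 8 \<alpha>1) N^3.\<close>
    have "\<forall>\<^sub>F N in at_top. \<alpha>2 - 7 * \<alpha>1 = (phi \<alpha>1 \<beta> N + phi \<alpha>2 \<beta> N - phi \<alpha>1 \<beta> (N + N)) / N ^ 3"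
      using eventually_gt_at_top[of 0]
      by eventually_elim (simp add: phi_def field_simps power2_eq_square power3_eq_cube)
    then have H: "((\<lambda>N. (phi \<alpha>1 \<beta> N + phi \<alpha>2 \<beta> N - phi \<alpha>1 \<beta> (N + N)) / N ^ 3) \<longlongrightarrow> \<alpha>2 - 7 * \<alpha>1) at_top"
      by (intro tendsto_eventually) (auto elim: eventually_mono)
    show ?thesis
    proof (rule no_bilinear_estimate_output_modulation[OF _ _ _ _ _ _ H ne(2)])
      show "((\<lambda>N::real. N / N) \<longlongrightarrow> 1) at_top" by real_asymp
      show "growth (\<lambda>N. \<bar>N + N\<bar>) 1"
        by (rule growthI[of _ _ 2]) (auto intro!: tendsto_eventually eventually_mono[OF eventually_gt_at_top[of 0]])
      show "growth (\<lambda>N. japan (N + N)) 1"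
        using growth_japan_linear[of 2] by (simp flip: mult_2)
    \<comment> \<open>Here \<open>k\<^sub>0\<close> = 1: the condition reads 4 s < 2 s + 6 (b - 1),
      because the gain 2 from the derivative offsets the loss -2 from the width.\<close>
    qed (use 3 in auto)
  qed
  then show ?thesis unfolding bilinear_estimate_def by blast
qed

end
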